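(* Let $Q$ be a quotient semigroup and let $\alpha$ be an equivalence class of maximal orders in $Q$. Then $(\mathcal F_v(\alpha),\cdot_v,\subset)$ is an arithmetical groupoid if and only if all $H\in\alpha$ (equivalently, one $H\in\alpha$) satisfy the following three conditions: (A1) $H$ satisfies the ACC on divisorial left $H$-ideals and the ACC on divisorial right $H$-ideals; (A2) $H$ is bounded; (A3) the lattice of divisorial fractional left $H$-ideals is modular, and the lattice of divisorial fractional right $H$-ideals is modular.
   Context: All semigroups are unital. $S^\bullet$ denotes the set of (left- and right-) cancellative elements of a semigroup $S$. A quotient semigroup is a semigroup $Q$ with $Q^\bullet=Q^\times$. A subsemigroup $H\subset Q$ is an order in $Q$ if every $q\in Q$ can be written as $q=as^{-1}=t^{-1}b$ with $a,b\in H$, $s,t\in H\cap Q^\bullet$. Orders $H,H'$ are equivalent if there are $a,b,c,d\in Q^\bullet$ with $aHb\subset H'$, $cH'd\subset H$; $H$ is maximal if it is maximal under inclusion in its equivalence class. An equivalence class $\alpha$ of maximal orders is the (non-empty) set of all maximal orders in one such equivalence class. For $X,Y\subset Q$: $XY=\{xy\mid x\in X,y\in Y\}$, $\mathcal O_l(X)=\{q\in Q\mid qX\subset X\}$, $\mathcal O_r(X)=\{q\in Q\mid Xq\subset X\}$, $X^{-1}=\{q\in Q\mid XqX\subset X\}$, $X_v=(X^{-1})^{-1}$. A fractional left $H$-ideal is an $I\subset Q$ with $HI\subset I$, $I\cap Q^\bullet\ne\emptyset$ and $Ic\subset H$ for some $c\in Q^\bullet$; a fractional right $H$-ideal is an $I\subset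 Q$ with $IH\subset I$, $I\cap Q^\bullet\neq\emptyset$ and $cI\subset H$ for some $c\in Q^\bullet$; a fractional $H$-ideal is both. A left (right) $H$-ideal is a fractional left (right) $H$-ideal contained in $H$. $I$ is divisorial if $I=I_v$. The divisorial fractional left (right) $H$-ideals, $H$ maximal, form a lattice under inclusion with meet $I\cap J$ and join $(I\cup J)_v$. $H$ is bounded if every fractional left $H$-ideal and every fractional right $H$-ideal contains a fractional (two-sided) $H$-ideal. $\mathcal F_v(\alpha)$ is the set of all divisorial fractional left (or right) $H$-ideals with $H\in\alpha$, with partial operation $I\cdot_vJ=(IJ)_v$ defined iff $\mathcal O_r(I)=\mathcal O_l(J)$, and ordered by inclusion. It is a groupoid with identities the elements of $\alpha$, $s(I)=\mathcal O_l(I)$, $t(I)=\mathcal O_r(I)$. Groupoid conventions: a groupoid $G$ is identified with its set of morphisms, $G_0$ is the set of identities, $s,t$ source and target, $ab$ is defined iff $t(a)=s(b)$; $G(e,f)=\{a\mid s(a)=e,t(a)=f\}$, $G(e,\cdot)=\{a\mid s(a)=e\}$, $G(\cdot,f)=\{a\mid t(a)=f\}$. A lattice-ordered groupoid is a groupoid $G$ with a relation $\le$ that restricts to a lattice order on every $G(e,\cdot)$ and every $G(\cdot,f)$, such that $G(e,f)$ is a sublattice of both, meets and joins of elements of $G(e,f)$ being the same in both. $a$ is integral if $a\le s(a)$ and $a\le t(a)$; $G_+$ is the set of integral elements. A lattice-ordered groupoid $G$ is arithmetical if for all $e,f\in G_0$: (P1) for $a\in G$, $a\le s(a)$ iff $a\le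 t(a)$; (P2) $G(e,\cdot)$ and $G(\cdot,f)$ are modular lattices; (P3) if $a\le b$ in $G(e,\cdot)$ and $c\in G(\cdot,e)$ then $ca\le cb$; if $a\le b$ in $G(\cdot,f)$ and $c\in G(f,\cdot)$ then $ac\le bc$; (P4) every non-empty $M\subset G(e,\cdot)\cap G_+$ has a supremum in $G(e,\cdot)$, every non-empty $M\subset G(\cdot,f)\cap G_+$ has a supremum in $G(\cdot,f)$, and for non-empty $M\subset G(e,f)\cap G_+$ these suprema coincide; (P5) $G(e,f)$ contains an integral element; (P6) $G(e,\cdot)$ and $G(\cdot,f)$ satisfy the ACC on integral elements. *)

theory Defs
  imports "HOL-Algebra.Lattice" "HOL-Library.Set_Algebras"
begin

section \<open>Order-theoretic notions\<close>

abbreviation subposet :: "('a \<Rightarrow> 'a \<Rightarrow> bool) \<Rightarrow> 'a set \<Rightarrow> 'a gorder" where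
  "subposet leq A \<equiv> \<lparr>carrier = A, eq = (=), le = leq\<rparr>"

definition modular_lattice :: "('a, 'b) gorder_scheme \<Rightarrow> bool" where
  "modular_lattice L \<longleftrightarrow> lattice L \<and>
     (\<forall>x\<in>carrier L. \<forall>y\<in>carrier L. \<forall>z\<in>carrier L.
        x \<sqsubseteq>\<^bsub>L\<^esub> z \<longrightarrow> x \<squnion>\<^bsub>L\<^esub> (y \<sqinter>\<^bsub>L\<^esub> z) = (x \<squnion>\<^bsub>L\<^esub> y) \<sqinter>\<^bsub>L\<^esub> z)"

definition ACC_on :: "('a \<Rightarrow> 'a \<Rightarrow> bool) \<Rightarrow> 'a set \<Rightarrow> bool" where
  "ACC_on leq A \<longleftrightarrow>
     (\<forall>x :: nat \<Rightarrow> 'a. (\<forall>n. x n \<in> A \<and> leq (x n) (x (Suc n))) \<longrightarrow> (\<exists>N. \<forall>n\<ge>N. x n = x N))"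


section \<open>Groupoids\<close>

text \<open>
  A groupoid is given by its set \<open>G\<close> of morphisms; source and target take values in the
  identities, which are themselves morphisms. Composition is written in diagrammatic order:
  \<open>a \<odot> b\<close> is meaningful precisely for \<open>a, b \<in> G\<close> with \<open>t a = s b\<close>, and its values
  on other arguments are irrelevant.
\<close>

locale groupoid =
  fixes G :: "'g set"
    and comp :: "'g \<Rightarrow> 'g \<Rightarrow> 'g" (infixl "\<odot>" 70)
    and s :: "'g \<Rightarrow> 'g"
    and t :: "'g \<Rightarrow> 'g"
  assumes source_closed: "a \<in> G \<Longrightarrow> s a \<in> G"
    and target_closed: "a \<in> G \<Longrightarrow> t a \<in> G"
    and source_source: "a \<in> G \<Longrightarrow> s (s a) = s a"
    and target_source: "a \<in> G \<Longrightarrow> t (s a) = s a"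
    and source_target: "a \<in> G \<Longrightarrow> s (t a) = t a"
    and target_target: "a \<in> G \<Longrightarrow> t (t a) = t a"
    and comp_closed: "\<lbrakk>a \<in> G; b \<in> G; t a = s b\<rbrakk> \<Longrightarrow> a \<odot> b \<in> G"
    and source_comp: "\<lbrakk>a \<in> G; b \<in> G; t a = s b\<rbrakk> \<Longrightarrow> s (a \<odot> b) = s a"
    and target_comp: "\<lbrakk>a \<in> G; b \<in> G; t a = s b\<rbrakk> \<Longrightarrow> t (a \<odot> b) = t b"
    and comp_assoc: "\<lbrakk>a \<in> G; b \<in> G; c \<in> G; t a = s b; t b = s c\<rbrakk>
                       \<Longrightarrow> (a \<odot> b) \<odot> c = a \<odot> (b \<odot> c)"
    and source_comp_left: "a \<in> G \<Longrightarrow> s a \<odot> a = a"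
    and target_comp_right: "a \<in> G \<Longrightarrow> a \<odot> t a = a"
    and inverse_exists: "a \<in> G \<Longrightarrow>
      \<exists>b\<in>G. s b = t a \<and> t b = s a \<and> a \<odot> b = s a \<and> b \<odot> a = t a"
begin

definition identities :: "'g set" where
  "identities = s ` G"

definition hom :: "'g \<Rightarrow> 'g \<Rightarrow> 'g set" where
  "hom e f = {a \<in> G. s a = e \<and> t a = f}"

definition hom_from :: "'g \<Rightarrow> 'g set" where
  "hom_from e = {a \<in> G. s a = e}"

definition hom_to :: "'g \<Rightarrow> 'g set" where
  "hom_to f = {a \<in> G. t a = f}"

end

locale lattice_ordered_groupoid = groupoid G comp s t
  for G :: "'g set" and comp :: "'g \<Rightarrow> 'g \<Rightarrow> 'g" (infixl "\<odot>" 70)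
    and s :: "'g \<Rightarrow> 'g" and t :: "'g \<Rightarrow> 'g" +
  fixes leq :: "'g \<Rightarrow> 'g \<Rightarrow> bool" (infix "\<preceq>" 50)
  assumes lattice_from: "e \<in> identities \<Longrightarrow> lattice (subposet (\<preceq>) (hom_from e))"
    and lattice_to: "f \<in> identities \<Longrightarrow> lattice (subposet (\<preceq>) (hom_to f))"
    and meet_closed: "\<lbrakk>e \<in> identities; f \<in> identities; a \<in> hom e f; b \<in> hom e f\<rbrakk>
      \<Longrightarrow> a \<sqinter>\<^bsub>subposet (\<preceq>) (hom_from e)\<^esub> b \<in> hom e f"
    and meet_agree: "\<lbrakk>e \<in> identities; f \<in> identities; a \<in> hom e f; b \<in> hom e f\<rbrakk>
      \<Longrightarrow> a \<sqinter>\<^bsub>subposet (\<preceq>) (hom_from e)\<^esub> b = a \<sqinter>\<^bsub>subposet (\<preceq>) (hom_to f)\<^esub> b"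
    and join_closed: "\<lbrakk>e \<in> identities; f \<in> identities; a \<in> hom e f; b \<in> hom e f\<rbrakk>
      \<Longrightarrow> a \<squnion>\<^bsub>subposet (\<preceq>) (hom_from e)\<^esub> b \<in> hom e f"
    and join_agree: "\<lbrakk>e \<in> identities; f \<in> identities; a \<in> hom e f; b \<in> hom e f\<rbrakk>
      \<Longrightarrow> a \<squnion>\<^bsub>subposet (\<preceq>) (hom_from e)\<^esub> b = a \<squnion>\<^bsub>subposet (\<preceq>) (hom_to f)\<^esub> b"
begin

definition integral :: "'g set" where
  "integral = {a \<in> G. a \<preceq> s a \<and> a \<preceq> t a}"

end

locale arithmetical_groupoid = lattice_ordered_groupoid G comp s t leq
  for G :: "'g set" and comp :: "'g \<Rightarrow> 'g \<Rightarrow> 'g" (infixl "\<odot>" 70)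
    and s :: "'g \<Rightarrow> 'g" and t :: "'g \<Rightarrow> 'g"
    and leq :: "'g \<Rightarrow> 'g \<Rightarrow> bool" (infix "\<preceq>" 50) +
  assumes P1: "a \<in> G \<Longrightarrow> a \<preceq> s a \<longleftrightarrow> a \<preceq> t a"
    and P2_from: "e \<in> identities \<Longrightarrow> modular_lattice (subposet (\<preceq>) (hom_from e))"
    and P2_to: "f \<in> identities \<Longrightarrow> modular_lattice (subposet (\<preceq>) (hom_to f))"
    and P3_left: "\<lbrakk>e \<in> identities; a \<in> hom_from e; b \<in> hom_from e; a \<preceq> b; c \<in> hom_to e\<rbrakk>
      \<Longrightarrow> c \<odot> a \<preceq> c \<odot> b"
    and P3_right: "\<lbrakk>f \<in> identities; a \<in> hom_to f; b \<in> hom_to f; a \<preceq> b; c \<in> hom_from f\<rbrakk>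
      \<Longrightarrow> a \<odot> c \<preceq> b \<odot> c"
    and P4_from: "\<lbrakk>e \<in> identities; M \<noteq> {}; M \<subseteq> hom_from e \<inter> integral\<rbrakk>
      \<Longrightarrow> \<exists>u. least (subposet (\<preceq>) (hom_from e)) u (Upper (subposet (\<preceq>) (hom_from e)) M)"
    and P4_to: "\<lbrakk>f \<in> identities; M \<noteq> {}; M \<subseteq> hom_to f \<inter> integral\<rbrakk>
      \<Longrightarrow> \<exists>u. least (subposet (\<preceq>) (hom_to f)) u (Upper (subposet (\<preceq>) (hom_to f)) M)"
    and P4_agree: "\<lbrakk>e \<in> identities; f \<in> identities; M \<noteq> {}; M \<subseteq> hom e f \<inter> integral\<rbrakk>
      \<Longrightarrow> \<Squnion>\<^bsub>subposet (\<preceq>) (hom_from e)\<^esub> M = \<Squnion>\<^bsub>subposet (\<preceq>) (hom_to f)\<^esub> M"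
    and P5: "\<lbrakk>e \<in> identities; f \<in> identities\<rbrakk> \<Longrightarrow> hom e f \<inter> integral \<noteq> {}"
    and P6_from: "e \<in> identities \<Longrightarrow> ACC_on (\<preceq>) (hom_from e \<inter> integral)"
    and P6_to: "f \<in> identities \<Longrightarrow> ACC_on (\<preceq>) (hom_to f \<inter> integral)"


section \<open>Quotient semigroups and orders\<close>

text \<open>
  The ambient (unital) semigroup \<open>Q\<close> is a type of class \<^class>\<open>monoid_mult\<close>. The product
  \<open>X * Y\<close> of sets is the elementwise product of \<^theory>\<open>HOL-Library.Set_Algebras\<close>.
\<close>

definition cancellatives :: "'a::monoid_mult set" where
  "cancellatives = {x. (\<forall>y z. x * y = x * z \<longrightarrow> y = z) \<and> (\<forall>y z. y * x = z * x \<longrightarrow> y = z)}"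

definition units :: "'a::monoid_mult set" where
  "units = {x. \<exists>y. x * y = 1 \<and> y * x = 1}"

text \<open>Only meaningful for elements of \<^const>\<open>units\<close>.\<close>

definition unit_inv :: "'a::monoid_mult \<Rightarrow> 'a" where
  "unit_inv x = (THE y. x * y = 1 \<and> y * x = 1)"

definition quotient_semigroup :: "'a::monoid_mult itself \<Rightarrow> bool" where
  "quotient_semigroup TYPE('a) \<longleftrightarrow> (cancellatives :: 'a set) = units"

definition subsemigroup :: "'a::monoid_mult set \<Rightarrow> bool" where
  "subsemigroup H \<longleftrightarrow> 1 \<in> H \<and> (\<forall>x\<in>H. \<forall>y\<in>H. x * y \<in> H)"

definition semigroup_order :: "'a::monoid_mult set \<Rightarrow> bool" where
  "semigroup_order H \<longleftrightarrow> subsemigroup H \<and>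
     (\<forall>q. \<exists>a\<in>H. \<exists>b\<in>H. \<exists>s\<in>H \<inter> cancellatives. \<exists>t\<in>H \<inter> cancellatives.
        q = a * unit_inv s \<and> q = unit_inv t * b)"

definition order_equiv :: "('a::monoid_mult set \<times> 'a set) set" where
  "order_equiv = {(H, H'). semigroup_order H \<and> semigroup_order H' \<and>
     (\<exists>a\<in>cancellatives. \<exists>b\<in>cancellatives. \<exists>c\<in>cancellatives. \<exists>d\<in>cancellatives.
        {a} * H * {b} \<subseteq> H' \<and> {c} * H' * {d} \<subseteq> H)}"

definition maximal_order :: "'a::monoid_mult set \<Rightarrow> bool" where
  "maximal_order H \<longleftrightarrow> semigroup_order H \<and> (\<forall>H'. (H, H') \<in> order_equiv \<and> H \<subseteq> H' \<longrightarrow> H' = H)"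

definition maximal_order_class :: "'a::monoid_mult set set \<Rightarrow> bool" where
  "maximal_order_class \<alpha> \<longleftrightarrow> \<alpha> \<noteq> {} \<and>
     (\<exists>C \<in> {H. semigroup_order H} // order_equiv. \<alpha> = {H \<in> C. maximal_order H})"


section \<open>Divisorial fractional ideals\<close>

definition left_order :: "'a::monoid_mult set \<Rightarrow> 'a set" where
  "left_order X = {q. {q} * X \<subseteq> X}"

definition right_order :: "'a::monoid_mult set \<Rightarrow> 'a set" where
  "right_order X = {q. X * {q} \<subseteq> X}"

definition ideal_inv :: "'a::monoid_mult set \<Rightarrow> 'a set" where
  "ideal_inv X = {q. X * {q} * X \<subseteq> X}"

definition v_closure :: "'a::monoid_mult set \<Rightarrow> 'a set" where
  "v_closure X = ideal_inv (ideal_inv X)"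

definition divisorial :: "'a::monoid_mult set \<Rightarrow> bool" where
  "divisorial I \<longleftrightarrow> v_closure I = I"

definition frac_left_ideal :: "'a::monoid_mult set \<Rightarrow> 'a set \<Rightarrow> bool" where
  "frac_left_ideal H I \<longleftrightarrow> H * I \<subseteq> I \<and> I \<inter> cancellatives \<noteq> {} \<and> (\<exists>c\<in>cancellatives. I * {c} \<subseteq> H)"

definition frac_right_ideal :: "'a::monoid_mult set \<Rightarrow> 'a set \<Rightarrow> bool" where
  "frac_right_ideal H I \<longleftrightarrow> I * H \<subseteq> I \<and> I \<inter> cancellatives \<noteq> {} \<and> (\<exists>c\<in>cancellatives. {c} * I \<subseteq> H)"

definition frac_ideal :: "'a::monoid_mult set \<Rightarrow> 'a set \<Rightarrow> bool" where
  "frac_ideal H I \<longleftrightarrow> frac_left_ideal H I \<and> frac_right_ideal H I"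

definition left_ideal :: "'a::monoid_mult set \<Rightarrow> 'a set \<Rightarrow> bool" where
  "left_ideal H I \<longleftrightarrow> frac_left_ideal H I \<and> I \<subseteq> H"

definition right_ideal :: "'a::monoid_mult set \<Rightarrow> 'a set \<Rightarrow> bool" where
  "right_ideal H I \<longleftrightarrow> frac_right_ideal H I \<and> I \<subseteq> H"

definition bounded_order :: "'a::monoid_mult set \<Rightarrow> bool" where
  "bounded_order H \<longleftrightarrow>
     (\<forall>I. frac_left_ideal H I \<longrightarrow> (\<exists>J. frac_ideal H J \<and> J \<subseteq> I)) \<and>
     (\<forall>I. frac_right_ideal H I \<longrightarrow> (\<exists>J. frac_ideal H J \<and> J \<subseteq> I))"

definition Fv :: "'a::monoid_mult set set \<Rightarrow> 'a set set" where
  "Fv \<alpha> = {I. \<exists>H\<in>\<alpha>. divisorial I \<and> (frac_left_ideal H I \<or> frac_right_ideal H I)}"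

definition v_mult :: "'a::monoid_mult set \<Rightarrow> 'a set \<Rightarrow> 'a set" where
  "v_mult I J = v_closure (I * J)"

definition ACC_divisorial :: "'a::monoid_mult set \<Rightarrow> bool" where
  "ACC_divisorial H \<longleftrightarrow>
     ACC_on (\<subseteq>) {I. left_ideal H I \<and> divisorial I} \<and>
     ACC_on (\<subseteq>) {I. right_ideal H I \<and> divisorial I}"

text \<open>
  Joins and meets here are those of the inclusion order; for maximal \<open>H\<close> they are
  \<open>v_closure (I \<union> J)\<close> and \<open>I \<inter> J\<close>.
\<close>

definition modular_divisorial :: "'a::monoid_mult set \<Rightarrow> bool" where
  "modular_divisorial H \<longleftrightarrow>
     modular_lattice (subposet (\<subseteq>) {I. frac_left_ideal H I \<and> divisorial I}) \<and>
     modular_lattice (subposet (\<subseteq>) {I. frac_right_ideal H I \<and> divisorial I})"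

end

theory Submission
  imports Defs
begin

text \<open>
  Call \<open>X\<close> a link from \<open>e\<close> to \<open>f\<close> (both in \<open>\<alpha>\<close>) if these are its left and right order and both
  \<open>X\<close> and its inverse contain units. Any two members of \<open>\<alpha>\<close> are linked, since \<open>c e d \<subseteq> f\<close> makes
  \<open>e d f\<close> a fractional right \<open>f\<close>-ideal, whose orders are forced by maximality. Multiplication by
  a link is an isomorphism of lattices of divisorial fractional ideals, and it preserves integral elements if
  the link is integral. Hence the modular law and the chain conditions move from one member of
  \<open>\<alpha>\<close> to all the others, and the only remaining axiom that is not automatic is the existence of
  integral links, which is equivalent to boundedness: a two-sided ideal inside the inverse of a
  link makes the link integral, and conversely, if \<open>J\<close> is an integral link from
  \<open>a\<inverse> H a\<close> to \<open>H\<close>, then \<open>a J\<close> is a two-sided \<open>H\<close>-ideal inside \<open>H a\<close>.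
\<close>

section \<open>Lattices of sets\<close>

text \<open>The obstacle is that \<open>ideal_inv\<close> is antitone only between sets sharing a
  left or a right order: enlarging \<open>X\<close> also changes the bound in
  \<open>X q X \<subseteq> X\<close>. Comparing two closures therefore requires knowing the orders
  on one side first, and maximality is the tool for that: a fractional left ideal of a member
  \<open>H\<close> of \<alpha> has left order exactly \<open>H\<close>. A second gap is that a
  divisorial fractional left ideal is tied to \<alpha> only through its left order; that its right
  order is again in \<alpha>, so that it has a target, has to be proved. Links carry no closure
  condition, so plain products and two-sided ideals are links, and v-closure is applied last. The
  modular law moves along any link, but the chain conditions need integral ones. Hence boundedness
  of the single given order \<open>h\<close> is spent first: it yields integral links between all
  pairs, routed through \<open>h\<close>, and only then can the chain conditions leave
  \<open>h\<close>.\<close>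

lemma partial_order_subset: "partial_order (subposet (\<subseteq>) A)"
  by unfold_locales simp_all

lemma least_subsetI:
  assumes "u \<in> A" "\<And>x. x \<in> M \<Longrightarrow> x \<subseteq> u" "\<And>w. w \<in> A \<Longrightarrow> (\<And>x. x \<in> M \<Longrightarrow> x \<subseteq> w) \<Longrightarrow> u \<subseteq> w"
    and "M \<subseteq> A"
  shows "least (subposet (\<subseteq>) A) u (Upper (subposet (\<subseteq>) A) M)"
  unfolding least_def Upper_def using assms by simp blast

lemma greatest_subsetI:
  assumes "u \<in> A" "\<And>x. x \<in> M \<Longrightarrow> u \<subseteq> x" "\<And>w. w \<in> A \<Longrightarrow> (\<And>x. x \<in> M \<Longrightarrow> w \<subseteq> x) \<Longrightarrow> w \<subseteq> u"
    and "M \<subseteq> A"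
  shows "greatest (subposet (\<subseteq>) A) u (Lower (subposet (\<subseteq>) A) M)"
  unfolding greatest_def Lower_def using assms by simp blast

lemma (in partial_order) sup_eqI: "least L u (Upper L M) \<Longrightarrow> \<Squnion> M = u"
  unfolding sup_def by (rule some_equality) (auto intro: least_unique)

lemma (in partial_order) inf_eqI: "greatest L u (Lower L M) \<Longrightarrow> \<Sqinter> M = u"
  unfolding inf_def by (rule some_equality) (auto intro: greatest_unique)

lemma lattice_subsetI:
  assumes "\<And>x y. x \<in> A \<Longrightarrow> y \<in> A \<Longrightarrow> \<exists>u. least (subposet (\<subseteq>) A) u (Upper (subposet (\<subseteq>) A) {x, y})"
    and "\<And>x y. x \<in> A \<Longrightarrow> y \<in> A \<Longrightarrow> \<exists>u. greatest (subposet (\<subseteq>) A) u (Lower (subposet (\<subseteq>) A) {x, y})"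
  shows "lattice (subposet (\<subseteq>) A)"
  by (intro lattice.intro upper_semilattice.intro lower_semilattice.intro partial_order_subset
      upper_semilattice_axioms.intro lower_semilattice_axioms.intro) (use assms in simp_all)

text \<open>Joins and meets are determined by the order: by surjectivity the join of the images is
  \<open>f w\<close> for some \<open>w\<close>, and since \<open>f\<close> reflects the order,
  \<open>w\<close> lies above the join of \<open>x\<close> and \<open>y\<close>. Reflection and
  antisymmetry also make \<open>f\<close> injective, so the modular identity can be pulled
  back.\<close>

lemma modular_lattice_iso:
  fixes L :: "('a, 'm) gorder_scheme" and M :: "('b, 'n) gorder_scheme"
  assumes M: "modular_lattice M" and L: "lattice L" and f: "f ` carrier L = carrier M"
    and le: "\<And>x y. x \<in> carrier L \<Longrightarrow> y \<in> carrier L \<Longrightarrow> f x \<sqsubseteq>\<^bsub>M\<^esub> f y \<longleftrightarrow> x \<sqsubseteq>\<^bsub>L\<^esub> y"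
  shows "modular_lattice L"
proof -
  interpret L: lattice L by (rule L)
  interpret M: lattice M using M by (simp add: modular_lattice_def)
  have f_closed: "f x \<in> carrier M" if "x \<in> carrier L" for x
    using f that by blast
  have inj: "x = y" if "x \<in> carrier L" "y \<in> carrier L" "f x = f y" for x y
  proof (rule L.le_antisym)
    show "x \<sqsubseteq>\<^bsub>L\<^esub> y" "y \<sqsubseteq>\<^bsub>L\<^esub> x"
      using le[OF that(1,2)] le[OF that(2,1)] M.le_refl[OF f_closed[OF that(1)]] that(3) by simp_all
  qed (use that in simp_all)
  have join: "f (x \<squnion>\<^bsub>L\<^esub> y) = f x \<squnion>\<^bsub>M\<^esub> f y" if x: "x \<in> carrier L" and y: "y \<in> carrier L" for x y
  proof (rule M.le_antisym)
    have "f x \<squnion>\<^bsub>M\<^esub> f y \<in> carrier M"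
      using x y f_closed by simp
    then obtain w where w: "w \<in> carrier L" "f w = f x \<squnion>\<^bsub>M\<^esub> f y"
      using f by (metis imageE)
    have "x \<sqsubseteq>\<^bsub>L\<^esub> w" "y \<sqsubseteq>\<^bsub>L\<^esub> w"
      using le[OF x w(1)] le[OF y w(1)] w(2) M.join_left M.join_right f_closed x y by simp_all
    then have "x \<squnion>\<^bsub>L\<^esub> y \<sqsubseteq>\<^bsub>L\<^esub> w"
      using L.join_le x y w(1) by blast
    then show "f (x \<squnion>\<^bsub>L\<^esub> y) \<sqsubseteq>\<^bsub>M\<^esub> f x \<squnion>\<^bsub>M\<^esub> f y"
      using le[of "x \<squnion>\<^bsub>L\<^esub> y" w] x y w by simp
    show "f x \<squnion>\<^bsub>M\<^esub> f y \<sqsubseteq>\<^bsub>M\<^esub> f (x \<squnion>\<^bsub>L\<^esub> y)"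
      using x y by (intro M.join_le f_closed) (simp_all add: le L.join_left L.join_right)
  qed (use x y f_closed in simp_all)
  have meet: "f (x \<sqinter>\<^bsub>L\<^esub> y) = f x \<sqinter>\<^bsub>M\<^esub> f y" if x: "x \<in> carrier L" and y: "y \<in> carrier L" for x y
  proof (rule M.le_antisym)
    have "f x \<sqinter>\<^bsub>M\<^esub> f y \<in> carrier M"
      using x y f_closed by simp
    then obtain w where w: "w \<in> carrier L" "f w = f x \<sqinter>\<^bsub>M\<^esub> f y"
      using f by (metis imageE)
    have "w \<sqsubseteq>\<^bsub>L\<^esub> x" "w \<sqsubseteq>\<^bsub>L\<^esub> y"
      using le[OF w(1) x] le[OF w(1) y] w(2) M.meet_left M.meet_right f_closed x y by simp_all
    then have "w \<sqsubseteq>\<^bsub>L\<^esub> x \<sqinter>\<^bsub>L\<^esub> y"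
      using L.meet_le x y w(1) by blast
    then show "f x \<sqinter>\<^bsub>M\<^esub> f y \<sqsubseteq>\<^bsub>M\<^esub> f (x \<sqinter>\<^bsub>L\<^esub> y)"
      using le[of w "x \<sqinter>\<^bsub>L\<^esub> y"] x y w by simp
    show "f (x \<sqinter>\<^bsub>L\<^esub> y) \<sqsubseteq>\<^bsub>M\<^esub> f x \<sqinter>\<^bsub>M\<^esub> f y"
      using x y by (intro M.meet_le f_closed) (simp_all add: le L.meet_left L.meet_right)
  qed (use x y f_closed in simp_all)
  show ?thesis
    unfolding modular_lattice_def
  proof (intro conjI L ballI impI)
    fix x y z assume c: "x \<in> carrier L" "y \<in> carrier L" "z \<in> carrier L" and xz: "x \<sqsubseteq>\<^bsub>L\<^esub> z"
    have "f x \<squnion>\<^bsub>M\<^esub> (f y \<sqinter>\<^bsub>M\<^esub> f z) = (f x \<squnion>\<^bsub>M\<^esub> f y) \<sqinter>\<^bsub>M\<^esub> f z"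
      using M[unfolded modular_lattice_def, THEN conjunct2, rule_format,
          OF f_closed[OF c(1)] f_closed[OF c(2)] f_closed[OF c(3)]] xz le[OF c(1,3)] by simp
    then have "f (x \<squnion>\<^bsub>L\<^esub> (y \<sqinter>\<^bsub>L\<^esub> z)) = f ((x \<squnion>\<^bsub>L\<^esub> y) \<sqinter>\<^bsub>L\<^esub> z)"
      using c by (simp add: join meet)
    then show "x \<squnion>\<^bsub>L\<^esub> (y \<sqinter>\<^bsub>L\<^esub> z) = (x \<squnion>\<^bsub>L\<^esub> y) \<sqinter>\<^bsub>L\<^esub> z"
      using c by (intro inj) simp_all
  qed
qed

text \<open>A monotone injection carries an ascending chain to one that becomes constant, and
  injectivity carries constancy back. The image may be a proper part of \<open>A\<close>, which
  matters when links act on integral elements.\<close>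

lemma ACC_on_embed:
  assumes A: "ACC_on leq A" and f: "\<And>x. x \<in> B \<Longrightarrow> f x \<in> A" and inj: "inj_on f B"
    and mono: "\<And>x y. x \<in> B \<Longrightarrow> y \<in> B \<Longrightarrow> leq' x y \<Longrightarrow> leq (f x) (f y)"
  shows "ACC_on leq' B"
  unfolding ACC_on_def
proof (intro allI impI)
  fix x :: "nat \<Rightarrow> _" assume x: "\<forall>n. x n \<in> B \<and> leq' (x n) (x (Suc n))"
  then have "\<forall>n. f (x n) \<in> A \<and> leq (f (x n)) (f (x (Suc n)))"
    using f mono by blast
  then obtain N where "\<forall>n\<ge>N. f (x n) = f (x N)"
    using A[unfolded ACC_on_def, THEN spec[of _ "\<lambda>n. f (x n)"]] by blast
  then show "\<exists>N. \<forall>n\<ge>N. x n = x N"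
    using inj x by (meson inj_onD)
qed

section \<open>Products of sets in a monoid\<close>

text \<open>These introduction rules make the classical reasoner diverge on inclusions between products.\<close>

declare set_times_mono [rule del] set_times_mono2 [rule del]
  set_times_mono3 [rule del] set_times_mono4 [rule del]

lemma singleton_times: "{a} * {b} = {a * b :: 'a::monoid_mult}"
  by (auto simp: set_times_def)

lemma times_mono_left: "X \<subseteq> Y \<Longrightarrow> X * Z \<subseteq> Y * (Z :: 'a::monoid_mult set)"
  by (rule set_times_mono2) auto

lemma times_mono_right: "X \<subseteq> Y \<Longrightarrow> Z * X \<subseteq> Z * (Y :: 'a::monoid_mult set)"
  by (rule set_times_mono2) auto

lemma times_subset_iff: "X * Y \<subseteq> Z \<longleftrightarrow> (\<forall>x\<in>X. \<forall>y\<in>Y. x * y \<in> (Z :: 'a::monoid_mult set))"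
  by (auto simp: set_times_def)

section \<open>One-sided orders, inverses and v-closures of arbitrary subsets\<close>

lemma subset_left_order_iff: "Y \<subseteq> left_order X \<longleftrightarrow> Y * X \<subseteq> X"
  by (auto simp: left_order_def times_subset_iff)

lemma subset_right_order_iff: "Y \<subseteq> right_order X \<longleftrightarrow> X * Y \<subseteq> X"
  by (auto simp: right_order_def times_subset_iff)

lemma subset_ideal_inv_iff: "Y \<subseteq> ideal_inv X \<longleftrightarrow> X * Y * X \<subseteq> X"
  unfolding ideal_inv_def by (simp add: subset_iff set_times_def) metis

text \<open>Bracketing \<open>X Y X \<subseteq> X\<close> on the left or on the right turns the
  symmetric inverse into a one-sided quotient by either order. Most later arguments about inverses
  choose one of these two readings.\<close>

lemma subset_ideal_inv_iff_left: "Y \<subseteq> ideal_inv X \<longleftrightarrow> X * Y \<subseteq> left_order X"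
  by (simp add: subset_ideal_inv_iff subset_left_order_iff)

lemma subset_ideal_inv_iff_right: "Y \<subseteq> ideal_inv X \<longleftrightarrow> Y * X \<subseteq> right_order X"
  by (simp add: subset_ideal_inv_iff subset_right_order_iff mult.assoc)

lemma left_order_times: "left_order X * X \<subseteq> X"
  using subset_left_order_iff by blast

lemma times_right_order: "X * right_order X \<subseteq> X"
  using subset_right_order_iff by blast

lemma times_ideal_inv: "X * ideal_inv X \<subseteq> left_order X"
  using subset_ideal_inv_iff_left by blast

lemma ideal_inv_times: "ideal_inv X * X \<subseteq> right_order X"
  using subset_ideal_inv_iff_right by blast

lemma times_ideal_inv_times: "X * ideal_inv X * X \<subseteq> X"
  using subset_ideal_inv_iff by blast

lemma one_in_left_order: "1 \<in> left_order X"
  by (simp add: left_order_def flip: set_one)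

lemma one_in_right_order: "1 \<in> right_order X"
  by (simp add: right_order_def flip: set_one)

lemma left_order_times_left_order: "left_order X * left_order X \<subseteq> left_order X"
  unfolding subset_left_order_iff mult.assoc
  using times_mono_right[OF left_order_times] left_order_times by blast

lemma right_order_times_right_order: "right_order X * right_order X \<subseteq> right_order X"
  unfolding subset_right_order_iff mult.assoc[symmetric]
  using times_mono_left[OF times_right_order] times_right_order by blast

lemma subsemigroup_iff: "subsemigroup H \<longleftrightarrow> 1 \<in> H \<and> H * H \<subseteq> H"
  by (auto simp: subsemigroup_def times_subset_iff)

lemma subsemigroup_left_order: "subsemigroup (left_order X)"
  by (simp add: subsemigroup_iff one_in_left_order left_order_times_left_order)

lemma subsemigroup_right_order: "subsemigroup (right_order X)"
  by (simp add: subsemigroup_iff one_in_right_order right_order_times_right_order)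

lemma left_order_subsemigroup:
  assumes "subsemigroup H" shows "left_order H = H"
proof
  show "left_order H \<subseteq> H"
    using assms by (force simp: left_order_def subsemigroup_iff times_subset_iff)
  show "H \<subseteq> left_order H"
    using assms by (simp add: subset_left_order_iff subsemigroup_iff)
qed

lemma right_order_subsemigroup:
  assumes "subsemigroup H" shows "right_order H = H"
proof
  show "right_order H \<subseteq> H"
    using assms by (force simp: right_order_def subsemigroup_iff times_subset_iff)
  show "H \<subseteq> right_order H"
    using assms by (simp add: subset_right_order_iff subsemigroup_iff)
qed

lemma ideal_inv_subsemigroup:
  assumes "subsemigroup H" shows "ideal_inv H = H"
proof
  have "H * ideal_inv H \<subseteq> H"
    using times_ideal_inv left_order_subsemigroup[OF assms] by metis
  then show "ideal_inv H \<subseteq> H"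
    using assms by (force simp: subsemigroup_iff times_subset_iff)
  show "H \<subseteq> ideal_inv H"
    using assms by (simp add: subset_ideal_inv_iff_left left_order_subsemigroup subsemigroup_iff)
qed

lemma v_closure_subsemigroup: "subsemigroup H \<Longrightarrow> v_closure H = H"
  by (simp add: v_closure_def ideal_inv_subsemigroup)

text \<open>An element \<open>x\<close> of \<open>X\<close> must satisfy
  \<open>X^-1 x X^-1 \<subseteq> X^-1\<close>. Wrapping this in \<open>X\<close> on both sides gives
  a part of \<open>X X^-1 X X^-1 X\<close>, which two cancellations put into
  \<open>X\<close>.\<close>

lemma subset_v_closure: "X \<subseteq> v_closure X"
proof -
  have "X * (ideal_inv X * X * ideal_inv X) * X = (X * ideal_inv X * X) * ideal_inv X * X"
    by (simp add: mult.assoc)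
  also have "\<dots> \<subseteq> X * ideal_inv X * X"
    by (intro times_mono_left times_ideal_inv_times)
  also have "\<dots> \<subseteq> X" by (rule times_ideal_inv_times)
  finally show ?thesis
    by (simp add: v_closure_def subset_ideal_inv_iff)
qed

text \<open>Inversion swaps the sides, in general only with an inclusion. Equality comes later,
  either from divisoriality by inverting twice or from maximality of the order.\<close>

lemma left_order_subset_right_order_inv: "left_order X \<subseteq> right_order (ideal_inv X)"
proof -
  have "X * (ideal_inv X * left_order X) * X = X * ideal_inv X * (left_order X * X)"
    by (simp add: mult.assoc)
  also have "\<dots> \<subseteq> X * ideal_inv X * X" by (intro times_mono_right left_order_times)
  also have "\<dots> \<subseteq> X" by (rule times_ideal_inv_times)
  finally show ?thesis by (simp add: subset_right_order_iff subset_ideal_inv_iff)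
qed

lemma right_order_subset_left_order_inv: "right_order X \<subseteq> left_order (ideal_inv X)"
proof -
  have "X * (right_order X * ideal_inv X) * X = (X * right_order X) * ideal_inv X * X"
    by (simp add: mult.assoc)
  also have "\<dots> \<subseteq> X * ideal_inv X * X" by (intro times_mono_left times_right_order)
  also have "\<dots> \<subseteq> X" by (rule times_ideal_inv_times)
  finally show ?thesis by (simp add: subset_left_order_iff subset_ideal_inv_iff)
qed

lemma right_order_inv_divisorial: "divisorial X \<Longrightarrow> right_order (ideal_inv X) = left_order X"
  using left_order_subset_right_order_inv[of X] right_order_subset_left_order_inv[of "ideal_inv X"]
  by (simp add: divisorial_def v_closure_def)

lemma left_order_inv_divisorial: "divisorial X \<Longrightarrow> left_order (ideal_inv X) = right_order X"
  using right_order_subset_left_order_inv[of X] left_order_subset_right_order_inv[of "ideal_inv X"]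
  by (simp add: divisorial_def v_closure_def)

lemma divisorial_inv: "divisorial X \<Longrightarrow> divisorial (ideal_inv X)"
  by (simp add: divisorial_def v_closure_def)

text \<open>The common left order is the bound in \<open>X q \<subseteq> left_order X\<close>; with
  the bound fixed, a larger set admits fewer \<open>q\<close>.\<close>

lemma ideal_inv_antimono_left:
  assumes "X \<subseteq> Y" "left_order X = left_order Y"
  shows "ideal_inv Y \<subseteq> ideal_inv X"
  using times_mono_left[OF assms(1), of "ideal_inv Y"] times_ideal_inv[of Y] assms(2)
  by (auto simp: subset_ideal_inv_iff_left)

lemma ideal_inv_antimono_right:
  assumes "X \<subseteq> Y" "right_order X = right_order Y"
  shows "ideal_inv Y \<subseteq> ideal_inv X"
  using times_mono_right[OF assms(1), of "ideal_inv Y"] ideal_inv_times[of Y] assms(2)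
  by (auto simp: subset_ideal_inv_iff_right)

text \<open>Both inclusions say \<open>X * X \<subseteq> X\<close>. This gives P1 and lets
  integrality of a link be tested at either end.\<close>

lemma subset_left_order_iff_subset_right_order: "X \<subseteq> left_order X \<longleftrightarrow> X \<subseteq> right_order X"
  by (simp add: subset_left_order_iff subset_right_order_iff)

text \<open>No order is mentioned, so the notion is symmetric in left and right. A unit
  \<open>c\<close> in \<open>ideal_inv X\<close> is a denominator on both sides:
  \<open>X * {c}\<close> lies in \<open>left_order X\<close> and \<open>{c} * X\<close> in
  \<open>right_order X\<close>.\<close>

definition fractional :: "'a::monoid_mult set \<Rightarrow> bool" where
  "fractional X \<longleftrightarrow> X \<inter> cancellatives \<noteq> {} \<and> ideal_inv X \<inter> cancellatives \<noteq> {}"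

lemma fractional_inv: "fractional X \<Longrightarrow> fractional (ideal_inv X)"
  using subset_v_closure[of X] by (auto simp: fractional_def v_closure_def)

section \<open>Equivalence of orders\<close>

locale order_class =
  fixes \<alpha> :: "'a::monoid_mult set set"
  assumes quotient: "quotient_semigroup TYPE('a)"
    and order_class: "maximal_order_class \<alpha>"
begin

abbreviation U :: "'a set" where "U \<equiv> cancellatives"

lemma unit_inv_mult: "u \<in> U \<Longrightarrow> u * unit_inv u = 1 \<and> unit_inv u * u = 1"
proof -
  assume "u \<in> U"
  then obtain v where v: "u * v = 1" "v * u = 1"
    using quotient unfolding quotient_semigroup_def units_def by blast
  have "w = v" if "u * w = 1 \<and> w * u = 1" for w
    by (metis that v(1) mult.assoc mult_1_left mult_1_right)
  with v have "\<exists>!w. u * w = 1 \<and> w * u = 1" by blast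
  then show ?thesis
    unfolding unit_inv_def by (rule theI')
qed

lemmas unit_inv_right [simp] = unit_inv_mult[THEN conjunct1]
  and unit_inv_left [simp] = unit_inv_mult[THEN conjunct2]

lemma unit_inv_right_assoc [simp]: "u \<in> U \<Longrightarrow> u * (unit_inv u * x) = x"
  by (metis mult.assoc mult_1_left unit_inv_right)

lemma unit_inv_left_assoc [simp]: "u \<in> U \<Longrightarrow> unit_inv u * (u * x) = x"
  by (metis mult.assoc mult_1_left unit_inv_left)

lemma unit_intro: "u * v = 1 \<Longrightarrow> v * u = 1 \<Longrightarrow> u \<in> U"
  using quotient unfolding quotient_semigroup_def units_def by blast

lemma unit_inv_unit [simp, intro]: "u \<in> U \<Longrightarrow> unit_inv u \<in> U"
  by (rule unit_intro[of _ u]) simp_all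

lemma one_unit [simp, intro]: "1 \<in> U"
  by (rule unit_intro[of _ 1]) simp_all

lemma mult_unit [simp, intro]: "u \<in> U \<Longrightarrow> v \<in> U \<Longrightarrow> u * v \<in> U"
  by (rule unit_intro[of _ "unit_inv v * unit_inv u"]) (simp_all add: mult.assoc)

lemma unit_inv_eqI: "u \<in> U \<Longrightarrow> u * v = 1 \<Longrightarrow> unit_inv u = v"
  by (metis unit_inv_left_assoc mult_1_right)

lemma unit_inv_times: "u \<in> U \<Longrightarrow> v \<in> U \<Longrightarrow> unit_inv (u * v) = unit_inv v * unit_inv u"
  by (rule unit_inv_eqI) (simp_all add: mult.assoc)

lemma singleton_inv_times [simp]: "u \<in> U \<Longrightarrow> {unit_inv u} * ({u} * X) = X"
  by (metis mult.assoc mult_1_left singleton_times set_one unit_inv_left)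

lemma singleton_times_inv [simp]: "u \<in> U \<Longrightarrow> {u} * ({unit_inv u} * X) = X"
  by (metis mult.assoc mult_1_left singleton_times set_one unit_inv_right)

lemma order_fractions:
  assumes "semigroup_order R"
  obtains a b s t where "a \<in> R" "b \<in> R" "s \<in> R" "s \<in> U" "t \<in> R" "t \<in> U"
    "q = a * unit_inv s" "q = unit_inv t * b"
  using assms[unfolded semigroup_order_def, THEN conjunct2, THEN spec[of _ q]]
  by (elim bexE conjE IntE) (rule that)

lemma order_right_denominator:
  assumes "semigroup_order R" shows "\<exists>s\<in>R \<inter> U. q * s \<in> R"
proof -
  obtain a s where s: "a \<in> R" "s \<in> R" "s \<in> U" and q: "q = a * unit_inv s"
    by (rule order_fractions[OF assms])
  have "q * s = a"
    unfolding q using s by (simp add: mult.assoc)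
  with s show ?thesis by blast
qed

lemma order_left_denominator:
  assumes "semigroup_order R" shows "\<exists>s\<in>R \<inter> U. s * q \<in> R"
proof -
  obtain a s where s: "a \<in> R" "s \<in> R" "s \<in> U" and q: "q = unit_inv s * a"
    by (rule order_fractions[OF assms])
  have "s * q = a"
    unfolding q using s by simp
  with s show ?thesis by blast
qed

lemma order_equivE:
  assumes "(H, K) \<in> order_equiv"
  obtains a b c d where "semigroup_order H" "semigroup_order K" "a \<in> U" "b \<in> U" "c \<in> U" "d \<in> U"
    "{a} * H * {b} \<subseteq> K" "{c} * K * {d} \<subseteq> H"
  using assms unfolding order_equiv_def by (elim CollectE case_prodE bexE conjE Pair_inject) (rule that, simp_all only:)

lemma order_equiv_intro:
  assumes "semigroup_order H" "semigroup_order K" "a \<in> U" "b \<in> U" "c \<in> U" "d \<in> U"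
    "{a} * H * {b} \<subseteq> K" "{c} * K * {d} \<subseteq> H"
  shows "(H, K) \<in> order_equiv"
  unfolding order_equiv_def using assms by blast

text \<open>For \<open>R\<close> only the subsemigroup property has to be known: sending
  \<open>h\<close> to \<open>c h d\<close> pushes numerators and denominators from \<open>H\<close>
  into \<open>R\<close>, which makes \<open>R\<close> an order.\<close>

lemma order_equivI:
  assumes H: "semigroup_order H" and R: "subsemigroup R"
    and u: "c \<in> U" "d \<in> U" "a \<in> U" "b \<in> U"
    and HR: "{c} * H * {d} \<subseteq> R" and RH: "{a} * R * {b} \<subseteq> H"
  shows "(H, R) \<in> order_equiv"
proof -
  have HR': "c * h * d \<in> R" if "h \<in> H" for h
    using HR that by (auto simp: times_subset_iff)
  have "\<exists>a\<in>R. \<exists>b\<in>R. \<exists>s\<in>R \<inter> U. \<exists>t\<in>R \<inter> U. q = a * unit_inv s \<and> q = unit_inv t * b" for q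
  proof -
    \<comment> \<open>Conjugation by \<open>c\<close> is chosen so that in
      \<open>(c x d) (c s d)^-1\<close> the factors \<open>d\<close> cancel and the outer
      \<open>c\<close> undo the conjugation. For left fractions the same works with conjugation by
      \<open>d\<close>.\<close>
    obtain x s where s: "x \<in> H" "s \<in> H" "s \<in> U" "unit_inv c * q * c = x * unit_inv s"
      by (rule order_fractions[OF H])
    obtain y t where t: "y \<in> H" "t \<in> H" "t \<in> U" "d * q * unit_inv d = unit_inv t * y"
      by (rule order_fractions[OF H])
    have "q = c * (unit_inv c * q * c) * unit_inv c"
      using u by (simp add: mult.assoc)
    also have "\<dots> = c * x * d * unit_inv (c * s * d)"
      unfolding s(4) using u s(3) by (simp add: mult.assoc unit_inv_times)
    finally have 1: "q = c * x * d * unit_inv (c * s * d)" .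
    have "q = unit_inv d * (d * q * unit_inv d) * d"
      using u by (simp add: mult.assoc)
    also have "\<dots> = unit_inv (c * t * d) * (c * y * d)"
      unfolding t(4) using u t(3) by (simp add: mult.assoc unit_inv_times)
    finally have 2: "q = unit_inv (c * t * d) * (c * y * d)" .
    have "c * s * d \<in> R \<inter> U" "c * t * d \<in> R \<inter> U" "c * x * d \<in> R" "c * y * d \<in> R"
      using HR' s t u by auto
    with 1 2 show ?thesis by blast
  qed
  then have "semigroup_order R"
    using R by (simp add: semigroup_order_def)
  with H show ?thesis
    using u HR RH by (rule order_equiv_intro)
qed

lemma order_equiv_equiv: "equiv {H :: 'a set. semigroup_order H} order_equiv"
proof (rule equivI)
  show "order_equiv \<subseteq> {H :: 'a set. semigroup_order H} \<times> {H. semigroup_order H}"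
    by (auto simp: order_equiv_def)
  have "(H, H) \<in> order_equiv" if "semigroup_order H" for H :: "'a set"
    using that order_equivI[of H H 1 1 1 1] by (simp add: semigroup_order_def flip: set_one)
  then show "refl_on {H :: 'a set. semigroup_order H} order_equiv"
    by (simp add: refl_on_def)
  show "sym (order_equiv :: ('a set \<times> 'a set) set)"
    by (rule symI, erule order_equivE) (rule order_equiv_intro)
  show "trans (order_equiv :: ('a set \<times> 'a set) set)"
  proof (rule transI)
    have comp: "{a' * a} * H * {b * b'} \<subseteq> K"
      if "{a} * H * {b} \<subseteq> H'" "{a'} * H' * {b'} \<subseteq> K" for a a' b b' and H H' K :: "'a set"
    proof -
      have "{a' * a} * H * {b * b'} = {a'} * ({a} * H * {b}) * {b'}"
        by (simp add: mult.assoc flip: singleton_times)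
      also have "\<dots> \<subseteq> {a'} * H' * {b'}"
        by (intro times_mono_left times_mono_right that)
      finally show ?thesis using that(2) by (rule subset_trans)
    qed
    fix H H' K :: "'a set"
    assume HH': "(H, H') \<in> order_equiv" and H'K: "(H', K) \<in> order_equiv"
    obtain a b c d where 1: "semigroup_order H" "a \<in> U" "b \<in> U" "c \<in> U" "d \<in> U"
      "{a} * H * {b} \<subseteq> H'" "{c} * H' * {d} \<subseteq> H"
      using HH' by (rule order_equivE)
    obtain a' b' c' d' where 2: "semigroup_order K" "a' \<in> U" "b' \<in> U" "c' \<in> U" "d' \<in> U"
      "{a'} * H' * {b'} \<subseteq> K" "{c'} * K * {d'} \<subseteq> H'"
      using H'K by (rule order_equivE)
    show "(H, K) \<in> order_equiv"
      using 1(1) 2(1) mult_unit[OF 2(2) 1(2)] mult_unit[OF 1(3) 2(3)] mult_unit[OF 1(4) 2(4)]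
        mult_unit[OF 2(5) 1(5)] comp[OF 1(6) 2(6)] comp[OF 2(7) 1(7)]
      by (rule order_equiv_intro)
  qed
qed

lemma order_equiv_trans:
  "(H, K) \<in> order_equiv \<Longrightarrow> (K, L) \<in> order_equiv \<Longrightarrow> (H, L) \<in> order_equiv" for H K L :: "'a set"
  using order_equiv_equiv by (meson equivE transE)

text \<open>The left multiplier \<open>a\<close> from the equivalence is replaced by
  \<open>t * a\<close>, with \<open>t\<close> a denominator of \<open>a\<close> in \<open>R\<close>,
  so that the multiplier lies in \<open>R\<close> itself. For an overorder \<open>S\<close> of
  \<open>R\<close> it then maps \<open>S\<close> into \<open>S\<close>, which is used when a right
  order is shown to be maximal.\<close>

lemma order_equiv_denominators:
  assumes "(R, H) \<in> order_equiv"
  obtains t b where "t \<in> R \<inter> U" "b \<in> U" "{t} * H * {b} \<subseteq> R"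
proof -
  obtain a b where R: "semigroup_order R" and ab: "a \<in> U" "b \<in> U" "{a} * H * {b} \<subseteq> R"
    using assms by (rule order_equivE)
  obtain t where t: "t \<in> R" "t \<in> U" "t * a \<in> R"
    using order_left_denominator[OF R] by blast
  have "{t * a} * H * {b} = {t} * ({a} * H * {b})"
    by (simp add: mult.assoc flip: singleton_times)
  also have "\<dots> \<subseteq> R * R"
    using t ab by (intro set_times_mono2) auto
  also have "\<dots> \<subseteq> R"
    using R by (simp add: semigroup_order_def subsemigroup_iff)
  finally show ?thesis
    using that[of "t * a" b] t ab by blast
qed

text \<open>A unit \<open>y\<close> of \<open>X\<close> and a unit \<open>x\<close> of
  \<open>ideal_inv X\<close> suffice: \<open>y (right_order X) x\<close> lies in
  \<open>X (right_order X) X^-1\<close>, where the order is absorbed, hence in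
  \<open>X X^-1\<close>. The other inclusion is symmetric.\<close>

lemma fractional_sandwich:
  fixes X :: "'a set"
  assumes "fractional X"
  obtains x y where "x \<in> U" "y \<in> U" "{y} * right_order X * {x} \<subseteq> left_order X"
    "{x} * left_order X * {y} \<subseteq> right_order X"
proof -
  obtain x y where x: "x \<in> ideal_inv X" "x \<in> U" and y: "y \<in> X" "y \<in> U"
    using assms by (auto simp: fractional_def)
  have "{y} * right_order X * {x} \<subseteq> (X * right_order X) * ideal_inv X"
    using x y by (intro set_times_mono2) auto
  also have "\<dots> \<subseteq> X * ideal_inv X" by (intro times_mono_left times_right_order)
  also have "\<dots> \<subseteq> left_order X" by (rule times_ideal_inv)
  finally have 1: "{y} * right_order X * {x} \<subseteq> left_order X" .
  have "{x} * left_order X * {y} \<subseteq> ideal_inv X * (left_order X * X)"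
    unfolding mult.assoc using x y by (intro set_times_mono2) auto
  also have "\<dots> \<subseteq> ideal_inv X * X" by (intro times_mono_right left_order_times)
  also have "\<dots> \<subseteq> right_order X" by (rule ideal_inv_times)
  finally show ?thesis using that[OF x(2) y(2) 1] by blast
qed

lemma left_right_order_equiv:
  fixes X :: "'a set"
  assumes "fractional X" "semigroup_order (left_order X)"
  shows "(left_order X, right_order X) \<in> order_equiv"
  using fractional_sandwich[OF assms(1)] order_equivI[OF assms(2) subsemigroup_right_order]
  by metis

lemma right_left_order_equiv:
  fixes X :: "'a set"
  assumes "fractional X" "semigroup_order (right_order X)"
  shows "(right_order X, left_order X) \<in> order_equiv"
  using fractional_sandwich[OF assms(1)] order_equivI[OF assms(2) subsemigroup_left_order]
  by metis

section \<open>Maximal orders\<close>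

lemma \<alpha>_semigroup_order: "H \<in> \<alpha> \<Longrightarrow> semigroup_order H"
  using order_class by (auto simp: maximal_order_class_def maximal_order_def)

lemma \<alpha>_subsemigroup: "H \<in> \<alpha> \<Longrightarrow> subsemigroup H"
  using \<alpha>_semigroup_order by (simp add: semigroup_order_def)

lemma \<alpha>_times: "H \<in> \<alpha> \<Longrightarrow> H * H \<subseteq> H" and \<alpha>_one: "H \<in> \<alpha> \<Longrightarrow> 1 \<in> H"
  using \<alpha>_subsemigroup by (simp_all add: subsemigroup_iff)

lemma \<alpha>_left_order: "H \<in> \<alpha> \<Longrightarrow> left_order H = H"
  and \<alpha>_right_order: "H \<in> \<alpha> \<Longrightarrow> right_order H = H"
  and \<alpha>_ideal_inv: "H \<in> \<alpha> \<Longrightarrow> ideal_inv H = H"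
  and \<alpha>_v_closure: "H \<in> \<alpha> \<Longrightarrow> v_closure H = H"
  using \<alpha>_subsemigroup
  by (simp_all add: left_order_subsemigroup right_order_subsemigroup ideal_inv_subsemigroup
      v_closure_subsemigroup)

lemma \<alpha>_equiv:
  assumes "H \<in> \<alpha>" "K \<in> \<alpha>" shows "(H, K) \<in> order_equiv"
proof -
  obtain C where C: "C \<in> {H. semigroup_order H} // order_equiv" "H \<in> C" "K \<in> C"
    using order_class assms by (auto simp: maximal_order_class_def)
  show ?thesis
    using quotient_eq_iff[OF order_equiv_equiv C(1,1,2,3)] by simp
qed

lemma \<alpha>_maximal:
  assumes "H \<in> \<alpha>" "(H, K) \<in> order_equiv" "H \<subseteq> K" shows "K = H"
  using assms order_class by (auto simp: maximal_order_class_def maximal_order_def)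

lemma \<alpha>_memI:
  assumes "H \<in> \<alpha>" "(H, K) \<in> order_equiv"
    and "\<And>L. (K, L) \<in> order_equiv \<Longrightarrow> K \<subseteq> L \<Longrightarrow> L \<subseteq> K"
  shows "K \<in> \<alpha>"
proof -
  obtain C where C: "C \<in> {H. semigroup_order H} // order_equiv"
    and \<alpha>: "\<alpha> = {H \<in> C. maximal_order H}"
    using order_class by (auto simp: maximal_order_class_def)
  have "K \<in> C"
    using in_quotient_imp_closed[OF order_equiv_equiv C] assms \<alpha> by blast
  moreover have "semigroup_order K"
    using assms(2) by (auto simp: order_equiv_def)
  ultimately show ?thesis
    unfolding \<alpha> maximal_order_def using assms(3) by blast
qed

lemma \<alpha>_nonempty: "\<alpha> \<noteq> {}"
  using order_class by (simp add: maximal_order_class_def)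

text \<open>With a unit \<open>y\<close> of \<open>X\<close> and \<open>X c \<subseteq> H\<close>,
  right multiplication by \<open>y c\<close> moves \<open>left_order X\<close> into
  \<open>H\<close>. So this overorder of \<open>H\<close> is equivalent to \<open>H\<close>, and
  maximality forces equality. Later, one-sided orders are computed just by exhibiting a set as a
  fractional ideal.\<close>

lemma frac_left_ideal_left_order:
  assumes H: "H \<in> \<alpha>" and X: "frac_left_ideal H X"
  shows "left_order X = H"
proof (rule \<alpha>_maximal[OF H])
  obtain c y where c: "c \<in> U" "X * {c} \<subseteq> H" and y: "y \<in> X" "y \<in> U"
    and HX: "H * X \<subseteq> X"
    using X by (auto simp: frac_left_ideal_def)
  show sub: "H \<subseteq> left_order X"
    using HX by (simp add: subset_left_order_iff)
  have "left_order X * {y} \<subseteq> left_order X * X"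
    using y by (intro times_mono_right) auto
  also have "\<dots> \<subseteq> X" by (rule left_order_times)
  finally have "left_order X * {y} * {c} \<subseteq> X * {c}"
    by (rule times_mono_left)
  then have "{1} * left_order X * {y * c} \<subseteq> H"
    using c(2) by (simp add: mult.assoc flip: set_one singleton_times)
  moreover have "{1} * H * {1} \<subseteq> left_order X"
    using sub by (simp flip: set_one)
  ultimately show "(H, left_order X) \<in> order_equiv"
    using y(2) c(1)
    by (intro order_equivI[OF \<alpha>_semigroup_order[OF H] subsemigroup_left_order, of 1 1 1 "y * c"])
      simp_all
qed

lemma frac_right_ideal_right_order:
  assumes H: "H \<in> \<alpha>" and X: "frac_right_ideal H X"
  shows "right_order X = H"
proof (rule \<alpha>_maximal[OF H])
  obtain c y where c: "c \<in> U" "{c} * X \<subseteq> H" and y: "y \<in> X" "y \<in> U"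
    and XH: "X * H \<subseteq> X"
    using X by (auto simp: frac_right_ideal_def)
  show sub: "H \<subseteq> right_order X"
    using XH by (simp add: subset_right_order_iff)
  have "{y} * right_order X \<subseteq> X * right_order X"
    using y by (intro times_mono_left) auto
  also have "\<dots> \<subseteq> X" by (rule times_right_order)
  finally have "{c} * ({y} * right_order X) \<subseteq> {c} * X"
    by (rule times_mono_right)
  then have "{c * y} * right_order X * {1} \<subseteq> H"
    using c(2) by (simp add: mult.assoc flip: set_one singleton_times)
  moreover have "{1} * H * {1} \<subseteq> right_order X"
    using sub by (simp flip: set_one)
  ultimately show "(H, right_order X) \<in> order_equiv"
    using y(2) c(1)
    by (intro order_equivI[OF \<alpha>_semigroup_order[OF H] subsemigroup_right_order, of 1 1 "c * y" 1])
      simp_all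
qed

lemma frac_left_ideal_iff:
  assumes H: "H \<in> \<alpha>"
  shows "frac_left_ideal H X \<longleftrightarrow> left_order X = H \<and> fractional X"
proof
  assume X: "frac_left_ideal H X"
  have l: "left_order X = H" by (rule frac_left_ideal_left_order[OF H X])
  obtain c where "c \<in> U" "X * {c} \<subseteq> H"
    using X by (auto simp: frac_left_ideal_def)
  then have "c \<in> ideal_inv X"
    using subset_ideal_inv_iff_left[of "{c}" X] l by simp
  then show "left_order X = H \<and> fractional X"
    using X l \<open>c \<in> U\<close> by (auto simp: frac_left_ideal_def fractional_def)
next
  assume X: "left_order X = H \<and> fractional X"
  then obtain c where c: "c \<in> U" "c \<in> ideal_inv X"
    by (auto simp: fractional_def)
  then have "X * {c} \<subseteq> H"
    using subset_ideal_inv_iff_left[of "{c}" X] X by simp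
  then show "frac_left_ideal H X"
    using X c left_order_times[of X] by (auto simp: frac_left_ideal_def fractional_def)
qed

lemma frac_right_ideal_iff:
  assumes H: "H \<in> \<alpha>"
  shows "frac_right_ideal H X \<longleftrightarrow> right_order X = H \<and> fractional X"
proof
  assume X: "frac_right_ideal H X"
  have l: "right_order X = H" by (rule frac_right_ideal_right_order[OF H X])
  obtain c where "c \<in> U" "{c} * X \<subseteq> H"
    using X by (auto simp: frac_right_ideal_def)
  then have "c \<in> ideal_inv X"
    using subset_ideal_inv_iff_right[of "{c}" X] l by simp
  then show "right_order X = H \<and> fractional X"
    using X l \<open>c \<in> U\<close> by (auto simp: frac_right_ideal_def fractional_def)
next
  assume X: "right_order X = H \<and> fractional X"
  then obtain c where c: "c \<in> U" "c \<in> ideal_inv X"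
    by (auto simp: fractional_def)
  then have "{c} * X \<subseteq> H"
    using subset_ideal_inv_iff_right[of "{c}" X] X by simp
  then show "frac_right_ideal H X"
    using X c times_right_order[of X] by (auto simp: frac_right_ideal_def fractional_def)
qed

text \<open>Here maximality takes the role that divisoriality has in
  \<open>right_order_inv_divisorial\<close>: the inverse is a fractional right ideal of
  \<open>left_order X\<close>, with any unit of \<open>X\<close> as denominator.\<close>

lemma right_order_inv:
  assumes "fractional X" "left_order X \<in> \<alpha>"
  shows "right_order (ideal_inv X) = left_order X"
proof (rule frac_right_ideal_right_order[OF assms(2)])
  obtain y where y: "y \<in> X" "y \<in> U" using assms(1) by (auto simp: fractional_def)
  have "{y} * ideal_inv X \<subseteq> X * ideal_inv X"
    using y by (intro times_mono_left) auto
  also have "\<dots> \<subseteq> left_order X" by (rule times_ideal_inv)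
  finally show "frac_right_ideal (left_order X) (ideal_inv X)"
    using assms(1) y(2) left_order_subset_right_order_inv[of X]
    by (auto simp: frac_right_ideal_def fractional_def subset_right_order_iff)
qed

lemma left_order_inv:
  assumes "fractional X" "right_order X \<in> \<alpha>"
  shows "left_order (ideal_inv X) = right_order X"
proof (rule frac_left_ideal_left_order[OF assms(2)])
  obtain y where y: "y \<in> X" "y \<in> U" using assms(1) by (auto simp: fractional_def)
  have "ideal_inv X * {y} \<subseteq> ideal_inv X * X"
    using y by (intro times_mono_right) auto
  also have "\<dots> \<subseteq> right_order X" by (rule ideal_inv_times)
  finally show "frac_left_ideal (right_order X) (ideal_inv X)"
    using assms(1) y(2) right_order_subset_left_order_inv[of X]
    by (auto simp: frac_left_ideal_def fractional_def subset_left_order_iff)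
qed

lemma fractional_v_closure: "fractional X \<Longrightarrow> fractional (v_closure X)" for X :: "'a set"
  by (simp add: v_closure_def fractional_inv)

lemma left_order_v_closure:
  "fractional X \<Longrightarrow> left_order X \<in> \<alpha> \<Longrightarrow> left_order (v_closure X) = left_order X"
  using left_order_inv[of "ideal_inv X"] right_order_inv[of X]
  by (simp add: v_closure_def fractional_inv)

lemma right_order_v_closure:
  "fractional X \<Longrightarrow> right_order X \<in> \<alpha> \<Longrightarrow> right_order (v_closure X) = right_order X"
  using right_order_inv[of "ideal_inv X"] left_order_inv[of X]
  by (simp add: v_closure_def fractional_inv)

text \<open>Three inversions equal one: \<open>X^-1\<close> lies in its own v-closure, and the
  converse is antitonicity applied to \<open>X \<subseteq> v_closure X\<close>, two sets with a
  common order on whichever side is known.\<close>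

lemma divisorial_v_closure:
  assumes "fractional X" "left_order X \<in> \<alpha> \<or> right_order X \<in> \<alpha>"
  shows "divisorial (v_closure X)"
proof -
  have "ideal_inv (v_closure X) \<subseteq> ideal_inv X"
    using assms ideal_inv_antimono_left[OF subset_v_closure[of X]]
      ideal_inv_antimono_right[OF subset_v_closure[of X]]
      left_order_v_closure right_order_v_closure by metis
  moreover have "ideal_inv X \<subseteq> ideal_inv (v_closure X)"
    using subset_v_closure[of "ideal_inv X"] by (simp add: v_closure_def)
  ultimately show ?thesis
    unfolding divisorial_def by (metis v_closure_def subset_antisym)
qed

text \<open>The two inversions use opposite sides: \<open>X\<close> and \<open>Y\<close> share a
  left order, so their inverses share a right order.\<close>

lemma v_closure_mono_left:
  assumes "fractional X" "fractional Y" "left_order X \<in> \<alpha>" "left_order Y = left_order X" "X \<subseteq> Y"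
  shows "v_closure X \<subseteq> v_closure Y"
  unfolding v_closure_def
  using assms by (intro ideal_inv_antimono_right ideal_inv_antimono_left) (simp_all add: right_order_inv)

lemma v_closure_mono_right:
  assumes "fractional X" "fractional Y" "right_order X \<in> \<alpha>" "right_order Y = right_order X" "X \<subseteq> Y"
  shows "v_closure X \<subseteq> v_closure Y"
  unfolding v_closure_def
  using assms by (intro ideal_inv_antimono_left ideal_inv_antimono_right) (simp_all add: left_order_inv)

text \<open>
  An overorder \<open>S\<close> of \<open>R = right_order I\<close> satisfies \<open>t S b \<subseteq> R\<close> with \<open>t \<in> R\<close>, but is not known to satisfy
  \<open>S b \<subseteq> R\<close>. So one first compares \<open>I t S\<close> with \<open>I\<close> to get \<open>t S \<subseteq> R\<close>, and then
  \<open>S I\<inverse>\<close> with \<open>I\<inverse>\<close> to get \<open>S \<subseteq> R\<close>; in both cases the order on the outer side is still \<open>H\<close>.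
\<close>

lemma right_order_mem:
  assumes I: "divisorial I" "fractional I" and H: "left_order I \<in> \<alpha>"
  shows "right_order I \<in> \<alpha>"
proof (rule \<alpha>_memI[OF H])
  let ?J = "ideal_inv I" and ?R = "right_order I" and ?H = "left_order I"
  show equiv: "(?H, ?R) \<in> order_equiv"
    using I H by (intro left_right_order_equiv \<alpha>_semigroup_order)
  obtain y where y: "y \<in> I" "y \<in> U" using I by (auto simp: fractional_def)
  obtain x where x: "x \<in> ?J" "x \<in> U" using I by (auto simp: fractional_def)
  \<comment> \<open>The assumption puts \<open>Y J\<close> into \<open>I^-1 = J\<close>, so
    \<open>Y\<close> lies in the left order of \<open>J\<close>. Divisoriality of \<open>I\<close>
    enters here: it makes that order equal to \<open>R\<close>.\<close>
  have subR: "Y \<subseteq> ?R" if "I * Y * ?J \<subseteq> ?H" for Y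
    using that left_order_inv_divisorial[OF I(1)]
    by (metis subset_ideal_inv_iff_left subset_left_order_iff mult.assoc)
  fix S assume S: "(?R, S) \<in> order_equiv" "?R \<subseteq> S"
  then have SS: "S * S \<subseteq> S" "1 \<in> S"
    by (auto simp: order_equiv_def semigroup_order_def subsemigroup_iff)
  have JIS: "?J * I \<subseteq> S" using ideal_inv_times[of I] S(2) by blast
  obtain t b where t: "t \<in> ?R" "t \<in> U" and b: "b \<in> U" and tb: "{t} * S * {b} \<subseteq> ?R"
    using S(1) by (rule order_equiv_denominators) blast
  let ?X = "I * {t} * S"
  have "left_order ?X = ?H"
  proof (rule frac_left_ideal_left_order[OF H])
    have "?H * ?X = (?H * I) * ({t} * S)" by (simp add: mult.assoc)
    also have "\<dots> \<subseteq> I * ({t} * S)" by (intro times_mono_left left_order_times)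
    finally have 1: "?H * ?X \<subseteq> ?X" by (simp add: mult.assoc)
    have "y * t * 1 \<in> ?X" using y SS by (intro set_times_intro) auto
    then have 2: "y * t \<in> ?X \<inter> U" using y t by simp
    have "?X * {b * x} = I * ({t} * S * {b}) * {x}"
      by (simp add: mult.assoc flip: singleton_times)
    also have "\<dots> \<subseteq> I * ?R * {x}" by (intro times_mono_left times_mono_right tb)
    also have "\<dots> \<subseteq> I * {x}" by (intro times_mono_left times_right_order)
    also have "\<dots> \<subseteq> I * ?J" using x by (intro times_mono_right) auto
    also have "\<dots> \<subseteq> ?H" by (rule times_ideal_inv)
    finally have "?X * {b * x} \<subseteq> ?H" .
    moreover have "b * x \<in> U" using b x by simp
    ultimately show "frac_left_ideal ?H ?X"
      using 1 2 unfolding frac_left_ideal_def by blast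
  qed
  \<comment> \<open>In \<open>I t S (J I) t S\<close> the factor \<open>J I\<close> lies in
    \<open>R\<close>, hence in \<open>S\<close>, and \<open>t S \<subseteq> S\<close>, so all is
    absorbed into \<open>I t S\<close>. Thus \<open>X J\<close> lies in the left order of
    \<open>X\<close>, just computed to be \<open>H\<close>.\<close>
  moreover have "?X * ?J * ?X \<subseteq> ?X"
  proof -
    have tS: "{t} * S \<subseteq> S"
      using S(2) t SS times_mono_left[of "{t}" S S] by auto
    have "?X * ?J * ?X = I * {t} * (S * ((?J * I) * ({t} * S)))" by (simp add: mult.assoc)
    also have "\<dots> \<subseteq> I * {t} * (S * (S * S))"
      by (intro times_mono_right set_times_mono2 JIS tS)
    also have "\<dots> \<subseteq> I * {t} * (S * S)" by (intro times_mono_right SS)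
    also have "\<dots> \<subseteq> I * {t} * S" by (intro times_mono_right SS)
    finally show ?thesis .
  qed
  ultimately have "?X * ?J \<subseteq> ?H" by (metis subset_left_order_iff)
  then have "I * ({t} * S) * ?J \<subseteq> ?H" by (simp add: mult.assoc)
  then have tSR: "{t} * S \<subseteq> ?R" by (rule subR)
  \<comment> \<open>Only now is a left denominator of \<open>S J\<close> available:
    \<open>t S \<subseteq> R\<close> gives
    \<open>y t S J \<subseteq> I R J \<subseteq> H\<close>.\<close>
  let ?Y = "S * ?J"
  have "right_order ?Y = ?H"
  proof (rule frac_right_ideal_right_order[OF H])
    have "?Y * ?H = S * (?J * ?H)" by (simp add: mult.assoc)
    also have "\<dots> \<subseteq> S * ?J"
      using left_order_subset_right_order_inv[of I]
      by (intro times_mono_right) (simp add: subset_right_order_iff)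
    finally have 1: "?Y * ?H \<subseteq> ?Y" .
    have "1 * x \<in> ?Y" using x SS by (intro set_times_intro) auto
    then have 2: "x \<in> ?Y \<inter> U" using x by simp
    have "{y * t} * ?Y = {y} * ({t} * S) * ?J"
      by (simp add: mult.assoc flip: singleton_times)
    also have "\<dots> \<subseteq> I * ?R * ?J" using y by (intro set_times_mono2 tSR) auto
    also have "\<dots> \<subseteq> I * ?J" by (intro times_mono_left times_right_order)
    also have "\<dots> \<subseteq> ?H" by (rule times_ideal_inv)
    finally have "{y * t} * ?Y \<subseteq> ?H" .
    moreover have "y * t \<in> U" using y t by simp
    ultimately show "frac_right_ideal ?H ?Y"
      using 1 2 unfolding frac_right_ideal_def by blast
  qed
  moreover have "?Y * (I * ?Y) \<subseteq> ?Y"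
  proof -
    have "?Y * (I * ?Y) = (S * ((?J * I) * S)) * ?J" by (simp add: mult.assoc)
    also have "\<dots> \<subseteq> (S * (S * S)) * ?J"
      by (intro times_mono_left times_mono_right JIS)
    also have "\<dots> \<subseteq> (S * S) * ?J" by (intro times_mono_left times_mono_right SS)
    also have "\<dots> \<subseteq> S * ?J" by (intro times_mono_left SS)
    finally show ?thesis .
  qed
  ultimately have "I * ?Y \<subseteq> ?H" by (metis subset_right_order_iff)
  then have "I * S * ?J \<subseteq> ?H" by (simp add: mult.assoc)
  then show "S \<subseteq> ?R" by (rule subR)
qed

text \<open>Inversion exchanges the two orders of a divisorial set.\<close>

lemma left_order_mem:
  assumes I: "divisorial I" "fractional I" and H: "right_order I \<in> \<alpha>"
  shows "left_order I \<in> \<alpha>"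
  using right_order_mem[of "ideal_inv I"] assms
  by (simp add: divisorial_inv fractional_inv right_order_inv_divisorial left_order_inv_divisorial)

section \<open>The groupoid of divisorial fractional ideals\<close>

text \<open>Divisoriality is not part of the notion, so that plain products and arbitrary two-sided
  ideals are links; \<open>v_closure\<close> turns a link into a morphism with the same
  ends.\<close>

definition linking :: "'a set \<Rightarrow> 'a set \<Rightarrow> 'a set \<Rightarrow> bool" where
  "linking e f X \<longleftrightarrow> fractional X \<and> left_order X = e \<and> right_order X = f \<and> e \<in> \<alpha> \<and> f \<in> \<alpha>"

text \<open>The inclusion \<open>X f \<subseteq> X\<close> makes \<open>right_order X\<close> an
  overorder of \<open>f\<close>. It is equivalent to \<open>e\<close> through \<open>X\<close>,
  hence to \<open>f\<close>, and maximality of \<open>f\<close> gives equality.\<close>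

lemma linkingI_left:
  assumes "e \<in> \<alpha>" "f \<in> \<alpha>" "X * f \<subseteq> X" "frac_left_ideal e X"
  shows "linking e f X"
proof -
  have l: "left_order X = e" "fractional X"
    using assms frac_left_ideal_iff by auto
  have "(e, right_order X) \<in> order_equiv"
    using left_right_order_equiv[of X] l assms(1) \<alpha>_semigroup_order by simp
  then have "(f, right_order X) \<in> order_equiv"
    using \<alpha>_equiv[OF assms(2,1)] order_equiv_trans by blast
  moreover have "f \<subseteq> right_order X"
    using assms(3) by (simp add: subset_right_order_iff)
  ultimately have "right_order X = f"
    by (rule \<alpha>_maximal[OF assms(2)])
  then show ?thesis
    using l assms by (simp add: linking_def)
qed

lemma linkingI_right:
  assumes "e \<in> \<alpha>" "f \<in> \<alpha>" "e * X \<subseteq> X" "frac_right_ideal f X"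
  shows "linking e f X"
proof -
  have l: "right_order X = f" "fractional X"
    using assms frac_right_ideal_iff by auto
  have "(f, left_order X) \<in> order_equiv"
    using right_left_order_equiv[of X] l assms(2) \<alpha>_semigroup_order by simp
  then have "(e, left_order X) \<in> order_equiv"
    using \<alpha>_equiv[OF assms(1,2)] order_equiv_trans by blast
  moreover have "e \<subseteq> left_order X"
    using assms(3) by (simp add: subset_left_order_iff)
  ultimately have "left_order X = e"
    by (rule \<alpha>_maximal[OF assms(1)])
  then show ?thesis
    using l assms by (simp add: linking_def)
qed

lemma linking_frac_left: "linking e f X \<Longrightarrow> frac_left_ideal e X"
  by (simp add: linking_def frac_left_ideal_iff)

lemma linking_frac_right: "linking e f X \<Longrightarrow> frac_right_ideal f X"
  by (simp add: linking_def frac_right_ideal_iff)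

lemma linking_inv: "linking e f X \<Longrightarrow> linking f e (ideal_inv X)"
  by (auto simp: linking_def fractional_inv left_order_inv right_order_inv)

lemma linking_v_closure: "linking e f X \<Longrightarrow> linking e f (v_closure X)"
  unfolding v_closure_def by (intro linking_inv)

lemma linking_divisorial: "linking e f X \<Longrightarrow> divisorial (v_closure X)"
  by (rule divisorial_v_closure) (auto simp: linking_def)

lemma linking_left_times: "linking e f X \<Longrightarrow> e * X \<subseteq> X"
  using left_order_times by (auto simp: linking_def)

lemma linking_times_right: "linking e f X \<Longrightarrow> X * f \<subseteq> X"
  using times_right_order by (auto simp: linking_def)

lemma linking_times_inv: "linking e f X \<Longrightarrow> X * ideal_inv X \<subseteq> e"
  using times_ideal_inv by (auto simp: linking_def)

lemma linking_inv_times: "linking e f X \<Longrightarrow> ideal_inv X * X \<subseteq> f"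
  using ideal_inv_times by (auto simp: linking_def)

lemma linking_self: "e \<in> \<alpha> \<Longrightarrow> linking e e e"
  using \<alpha>_one[of e]
  by (auto simp: linking_def fractional_def \<alpha>_left_order \<alpha>_right_order \<alpha>_ideal_inv)

section \<open>Products of links and their v-closures\<close>

lemma linking_mult:
  assumes X: "linking e f X" and Y: "linking f g Y"
  shows "linking e g (X * Y)"
proof (rule linkingI_left)
  show "e \<in> \<alpha>" "g \<in> \<alpha>" using X Y by (auto simp: linking_def)
  show "X * Y * g \<subseteq> X * Y"
    using times_mono_right[OF linking_times_right[OF Y], of X] by (simp add: mult.assoc)
  obtain x y where x: "x \<in> X" "x \<in> U" and y: "y \<in> Y" "y \<in> U"
    using X Y by (auto simp: linking_def fractional_def)
  obtain a b where a: "a \<in> ideal_inv X" "a \<in> U" and b: "b \<in> ideal_inv Y" "b \<in> U"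
    using X Y by (auto simp: linking_def fractional_def)
  have 1: "e * (X * Y) \<subseteq> X * Y"
    using times_mono_left[OF linking_left_times[OF X], of Y] by (simp add: mult.assoc)
  have 2: "x * y \<in> X * Y \<inter> U" using x y by auto
  \<comment> \<open>Denominators cancel from the inside out: \<open>b\<close> sends \<open>Y\<close>
    into \<open>f\<close>, which \<open>X\<close> absorbs, and \<open>a\<close> then sends
    \<open>X\<close> into \<open>e\<close>.\<close>
  have "X * Y * {b * a} = X * (Y * {b}) * {a}"
    by (simp add: mult.assoc flip: singleton_times)
  also have "\<dots> \<subseteq> X * (Y * ideal_inv Y) * ideal_inv X"
    using a b by (intro set_times_mono2) auto
  also have "\<dots> \<subseteq> X * f * ideal_inv X"
    by (intro times_mono_left times_mono_right linking_times_inv[OF Y])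
  also have "\<dots> \<subseteq> X * ideal_inv X"
    by (intro times_mono_left linking_times_right[OF X])
  also have "\<dots> \<subseteq> e" by (rule linking_times_inv[OF X])
  finally have "X * Y * {b * a} \<subseteq> e" .
  then show "frac_left_ideal e (X * Y)"
    unfolding frac_left_ideal_def using 1 2 a b mult_unit by blast
qed

text \<open>Closing a factor early changes nothing, which makes \<open>v_mult\<close> associative.
  From \<open>X (Y (X Y)^-1) \<subseteq> e\<close> it follows that
  \<open>Y (X Y)^-1 \<subseteq> X^-1\<close>, and \<open>X^-1\<close> still multiplies the closure
  of \<open>X\<close> into \<open>e\<close>. So the closure of \<open>X\<close>, times
  \<open>Y\<close>, is carried into \<open>e\<close> by \<open>(X Y)^-1\<close> and lies in the
  closure of \<open>X Y\<close>.\<close>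

lemma v_closure_times_left:
  assumes X: "linking e f X" and Y: "linking f g Y"
  shows "v_closure (v_closure X * Y) = v_closure (X * Y)"
proof
  note XY = linking_mult[OF X Y] and vXY = linking_mult[OF linking_v_closure[OF X] Y]
  show "v_closure (X * Y) \<subseteq> v_closure (v_closure X * Y)"
    using XY vXY
    by (intro v_closure_mono_left times_mono_left subset_v_closure) (auto simp: linking_def)
  have "X * (Y * ideal_inv (X * Y)) \<subseteq> left_order X"
    using linking_times_inv[OF XY] X by (simp add: mult.assoc linking_def)
  then have "Y * ideal_inv (X * Y) \<subseteq> ideal_inv X"
    by (simp add: subset_ideal_inv_iff_left)
  then have "v_closure X * (Y * ideal_inv (X * Y)) \<subseteq> ideal_inv (ideal_inv X) * ideal_inv X"
    unfolding v_closure_def by (rule times_mono_right)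
  also have "\<dots> \<subseteq> e" by (rule linking_inv_times[OF linking_inv[OF X]])
  finally have "v_closure X * Y * ideal_inv (X * Y) \<subseteq> right_order (ideal_inv (X * Y))"
    using linking_inv[OF XY] by (simp add: linking_def mult.assoc)
  then have "v_closure X * Y \<subseteq> v_closure (X * Y)"
    unfolding v_closure_def by (subst subset_ideal_inv_iff_right)
  then have "v_closure (v_closure X * Y) \<subseteq> v_closure (v_closure (X * Y))"
    using vXY linking_v_closure[OF XY] by (intro v_closure_mono_left) (auto simp: linking_def)
  then show "v_closure (v_closure X * Y) \<subseteq> v_closure (X * Y)"
    using linking_divisorial[OF XY] by (simp add: divisorial_def)
qed

lemma v_closure_times_right:
  assumes X: "linking e f X" and Y: "linking f g Y"
  shows "v_closure (X * v_closure Y) = v_closure (X * Y)"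
proof
  note XY = linking_mult[OF X Y] and XvY = linking_mult[OF X linking_v_closure[OF Y]]
  show "v_closure (X * Y) \<subseteq> v_closure (X * v_closure Y)"
    using XY XvY
    by (intro v_closure_mono_left times_mono_right subset_v_closure) (auto simp: linking_def)
  have "(ideal_inv (X * Y) * X) * Y \<subseteq> right_order Y"
    using linking_inv_times[OF XY] Y by (simp add: mult.assoc linking_def)
  then have "ideal_inv (X * Y) * X \<subseteq> ideal_inv Y"
    by (simp add: subset_ideal_inv_iff_right)
  then have "(ideal_inv (X * Y) * X) * v_closure Y \<subseteq> ideal_inv Y * ideal_inv (ideal_inv Y)"
    unfolding v_closure_def by (rule times_mono_left)
  also have "\<dots> \<subseteq> g" by (rule linking_times_inv[OF linking_inv[OF Y]])
  finally have "ideal_inv (X * Y) * (X * v_closure Y) \<subseteq> left_order (ideal_inv (X * Y))"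
    using linking_inv[OF XY] by (simp add: linking_def mult.assoc)
  then have "X * v_closure Y \<subseteq> v_closure (X * Y)"
    unfolding v_closure_def by (subst subset_ideal_inv_iff_left)
  then have "v_closure (X * v_closure Y) \<subseteq> v_closure (v_closure (X * Y))"
    using XvY linking_v_closure[OF XY] by (intro v_closure_mono_left) (auto simp: linking_def)
  then show "v_closure (X * v_closure Y) \<subseteq> v_closure (X * Y)"
    using linking_divisorial[OF XY] by (simp add: divisorial_def)
qed

text \<open>Put \<open>Z = (X X^-1)^-1\<close>. From \<open>X (X^-1 Z) \<subseteq> e\<close> follows
  \<open>X^-1 Z \<subseteq> X^-1\<close>, so \<open>Z\<close> lies in the right order of
  \<open>X^-1\<close>, which is \<open>e\<close>. Hence \<open>Z = e\<close>, and \<open>e\<close>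
  is its own inverse.\<close>

lemma v_closure_times_inv:
  assumes X: "linking e f X" shows "v_closure (X * ideal_inv X) = e"
proof -
  note L = linking_mult[OF X linking_inv[OF X]]
  have e: "e \<in> \<alpha>" using X by (simp add: linking_def)
  have "X * (ideal_inv X * ideal_inv (X * ideal_inv X)) \<subseteq> left_order X"
    using linking_times_inv[OF L] X by (simp add: mult.assoc linking_def)
  then have "ideal_inv X * ideal_inv (X * ideal_inv X) \<subseteq> ideal_inv X"
    by (simp add: subset_ideal_inv_iff_left)
  then have "ideal_inv (X * ideal_inv X) \<subseteq> right_order (ideal_inv X)"
    by (simp add: subset_right_order_iff)
  then have "ideal_inv (X * ideal_inv X) \<subseteq> e"
    using linking_inv[OF X] by (simp add: linking_def)
  moreover have "e \<subseteq> ideal_inv (X * ideal_inv X)"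
    using ideal_inv_antimono_left[OF linking_times_inv[OF X]] L e
    by (simp add: \<alpha>_ideal_inv \<alpha>_left_order linking_def)
  ultimately show ?thesis
    using e by (simp add: v_closure_def \<alpha>_ideal_inv)
qed

text \<open>The preceding law for \<open>X^-1\<close> has \<open>v_closure X\<close> as its second
  factor; replacing it by \<open>X\<close> does not change the closure of the product.\<close>

lemma v_closure_inv_times:
  assumes X: "linking e f X" shows "v_closure (ideal_inv X * X) = f"
proof -
  have "v_closure (ideal_inv X * X) = v_closure (ideal_inv X * v_closure X)"
    by (rule v_closure_times_right[OF linking_inv[OF X] X, symmetric])
  also have "\<dots> = f"
    unfolding v_closure_def[of X] by (rule v_closure_times_inv[OF linking_inv[OF X]])
  finally show ?thesis .
qed

text \<open>Membership in \<open>Fv \<alpha>\<close> constrains one side only;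
  \<open>right_order_mem\<close> and \<open>left_order_mem\<close> supply the other, so that both
  source and target are identities.\<close>

lemma Fv_iff:
  "I \<in> Fv \<alpha> \<longleftrightarrow> divisorial I \<and> linking (left_order I) (right_order I) I"
proof
  assume "I \<in> Fv \<alpha>"
  then have I: "divisorial I" "fractional I" "left_order I \<in> \<alpha> \<or> right_order I \<in> \<alpha>"
    by (auto simp: Fv_def frac_left_ideal_iff frac_right_ideal_iff)
  with left_order_mem[OF I(1,2)] right_order_mem[OF I(1,2)]
  show "divisorial I \<and> linking (left_order I) (right_order I) I"
    unfolding linking_def by blast
next
  assume "divisorial I \<and> linking (left_order I) (right_order I) I"
  then show "I \<in> Fv \<alpha>"
    unfolding Fv_def linking_def using frac_left_ideal_iff by blast
qed

lemma Fv_linking: "I \<in> Fv \<alpha> \<Longrightarrow> linking (left_order I) (right_order I) I"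
  by (simp add: Fv_iff)

lemma linking_Fv: "linking e f I \<Longrightarrow> divisorial I \<Longrightarrow> I \<in> Fv \<alpha>"
  by (simp add: Fv_iff linking_def)

lemma linking_v_closure_Fv: "linking e f X \<Longrightarrow> v_closure X \<in> Fv \<alpha>"
  by (intro linking_Fv linking_v_closure linking_divisorial)

lemma Fv_v_closure: "I \<in> Fv \<alpha> \<Longrightarrow> v_closure I = I"
  by (simp add: Fv_iff divisorial_def)

lemma \<alpha>_Fv: "e \<in> \<alpha> \<Longrightarrow> e \<in> Fv \<alpha>"
  using linking_Fv[OF linking_self] by (simp add: divisorial_def \<alpha>_v_closure)

lemma linking_v_mult: "linking e f X \<Longrightarrow> linking f g Y \<Longrightarrow> linking e g (v_mult X Y)"
  unfolding v_mult_def by (intro linking_v_closure linking_mult)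

lemma v_mult_Fv: "linking e f X \<Longrightarrow> linking f g Y \<Longrightarrow> v_mult X Y \<in> Fv \<alpha>"
  unfolding v_mult_def by (intro linking_v_closure_Fv linking_mult)

lemma v_mult_assoc:
  assumes "linking e f X" "linking f g Y" "linking g h Z"
  shows "v_mult (v_mult X Y) Z = v_mult X (v_mult Y Z)"
  unfolding v_mult_def
    v_closure_times_left[OF linking_mult[OF assms(1,2)] assms(3)]
    v_closure_times_right[OF assms(1) linking_mult[OF assms(2,3)]]
  by (simp add: mult.assoc)

lemma v_mult_left_unit: "X \<in> Fv \<alpha> \<Longrightarrow> v_mult (left_order X) X = X"
proof -
  assume X: "X \<in> Fv \<alpha>"
  have "X \<subseteq> left_order X * X"
    using set_times_intro[OF one_in_left_order] by fastforce
  then have "left_order X * X = X" using left_order_times by blast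
  then show ?thesis using X by (simp add: v_mult_def Fv_v_closure)
qed

lemma v_mult_right_unit: "X \<in> Fv \<alpha> \<Longrightarrow> v_mult X (right_order X) = X"
proof -
  assume X: "X \<in> Fv \<alpha>"
  have "X \<subseteq> X * right_order X"
    using set_times_intro[OF _ one_in_right_order] by fastforce
  then have "X * right_order X = X" using times_right_order by blast
  then show ?thesis using X by (simp add: v_mult_def Fv_v_closure)
qed

text \<open>The inner orders may differ: the closure is monotone because both products have left
  order \<open>e\<close>.\<close>

lemma v_mult_mono:
  assumes "linking e f X" "linking e f' X'" "linking f g Y" "linking f' g' Y'" "X \<subseteq> X'" "Y \<subseteq> Y'"
  shows "v_mult X Y \<subseteq> v_mult X' Y'"
  unfolding v_mult_def
  using linking_mult[OF assms(1,3)] linking_mult[OF assms(2,4)] set_times_mono2[OF assms(5,6)]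
  by (intro v_closure_mono_left) (auto simp: linking_def)

lemma v_mult_mono_right:
  assumes "linking e f X" "linking e' f' X'" "linking f g Y" "linking f' g Y'" "X \<subseteq> X'" "Y \<subseteq> Y'"
  shows "v_mult X Y \<subseteq> v_mult X' Y'"
  unfolding v_mult_def
  using linking_mult[OF assms(1,3)] linking_mult[OF assms(2,4)] set_times_mono2[OF assms(5,6)]
  by (intro v_closure_mono_right) (auto simp: linking_def)

sublocale F: groupoid "Fv \<alpha>" v_mult left_order right_order
proof
  fix a assume a: "a \<in> Fv \<alpha>"
  then have \<alpha>: "left_order a \<in> \<alpha>" "right_order a \<in> \<alpha>"
    by (auto simp: Fv_iff linking_def)
  then show "left_order a \<in> Fv \<alpha>" "right_order a \<in> Fv \<alpha>"
    "left_order (left_order a) = left_order a" "right_order (left_order a) = left_order a"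
    "left_order (right_order a) = right_order a" "right_order (right_order a) = right_order a"
    by (simp_all add: \<alpha>_Fv \<alpha>_left_order \<alpha>_right_order)
  show "v_mult (left_order a) a = a" "v_mult a (right_order a) = a"
    using a by (simp_all add: v_mult_left_unit v_mult_right_unit)
  note L = Fv_linking[OF a]
  have "ideal_inv a \<in> Fv \<alpha>"
    using linking_Fv[OF linking_inv[OF L]] a by (simp add: Fv_iff divisorial_inv)
  moreover have "left_order (ideal_inv a) = right_order a" "right_order (ideal_inv a) = left_order a"
    using linking_inv[OF L] by (simp_all add: linking_def)
  moreover have "v_mult a (ideal_inv a) = left_order a" "v_mult (ideal_inv a) a = right_order a"
    using v_closure_times_inv[OF L] v_closure_inv_times[OF L] by (simp_all add: v_mult_def)
  ultimately show "\<exists>b\<in>Fv \<alpha>. left_order b = right_order a \<and> right_order b = left_order a \<and>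
    v_mult a b = left_order a \<and> v_mult b a = right_order a"
    by blast
next
  fix a b assume a: "a \<in> Fv \<alpha>" and b: "b \<in> Fv \<alpha>" and eq: "right_order a = left_order b"
  note L = Fv_linking[OF a, unfolded eq] Fv_linking[OF b]
  from v_mult_Fv[OF L] linking_v_mult[OF L]
  show "v_mult a b \<in> Fv \<alpha>" "left_order (v_mult a b) = left_order a"
    "right_order (v_mult a b) = right_order b"
    by (simp_all add: linking_def)
next
  fix a b c assume a: "a \<in> Fv \<alpha>" and b: "b \<in> Fv \<alpha>" and c: "c \<in> Fv \<alpha>"
    and eq: "right_order a = left_order b" "right_order b = left_order c"
  show "v_mult (v_mult a b) c = v_mult a (v_mult b c)"
    by (rule v_mult_assoc[OF Fv_linking[OF a, unfolded eq(1)] Fv_linking[OF b, unfolded eq(2)]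
          Fv_linking[OF c]])
qed

lemma identities_eq: "F.identities = \<alpha>"
proof
  show "F.identities \<subseteq> \<alpha>"
    by (auto simp: F.identities_def Fv_iff linking_def)
  show "\<alpha> \<subseteq> F.identities"
    unfolding F.identities_def using \<alpha>_Fv \<alpha>_left_order by (metis imageI subsetI)
qed

lemma hom_iff: "I \<in> F.hom e f \<longleftrightarrow> divisorial I \<and> linking e f I"
  by (auto simp: F.hom_def Fv_iff linking_def)

lemma hom_from_iff: "I \<in> F.hom_from e \<longleftrightarrow> divisorial I \<and> linking e (right_order I) I"
  by (auto simp: F.hom_from_def Fv_iff linking_def)

lemma hom_to_iff: "I \<in> F.hom_to f \<longleftrightarrow> divisorial I \<and> linking (left_order I) f I"
  by (auto simp: F.hom_to_def Fv_iff linking_def)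

lemma hom_from_eq: "e \<in> \<alpha> \<Longrightarrow> F.hom_from e = {I. frac_left_ideal e I \<and> divisorial I}"
  unfolding F.hom_from_def
  by (auto simp: Fv_iff linking_def frac_left_ideal_iff intro: right_order_mem)

lemma hom_to_eq: "f \<in> \<alpha> \<Longrightarrow> F.hom_to f = {I. frac_right_ideal f I \<and> divisorial I}"
  unfolding F.hom_to_def
  by (auto simp: Fv_iff linking_def frac_right_ideal_iff intro: left_order_mem)

section \<open>Lattice structure\<close>

lemma frac_left_ideal_common_denominator:
  assumes e: "e \<in> \<alpha>" and X: "frac_left_ideal e X" and Y: "frac_left_ideal e Y"
  obtains c where "c \<in> U" "X * {c} \<subseteq> e" "Y * {c} \<subseteq> e"
proof -
  obtain c d where c: "c \<in> U" "X * {c} \<subseteq> e" and d: "d \<in> U" "Y * {d} \<subseteq> e"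
    using X Y by (auto simp: frac_left_ideal_def)
  \<comment> \<open>The common denominator is \<open>d s\<close>: it equals \<open>c\<close> times
    an element of \<open>e\<close>, so it also works for \<open>X\<close>.\<close>
  obtain s where s: "s \<in> e" "s \<in> U" "unit_inv c * d * s \<in> e"
    using order_right_denominator[OF \<alpha>_semigroup_order[OF e]] by blast
  have "X * {d * s} = X * {c} * {unit_inv c * d * s}"
    using c by (simp add: mult.assoc singleton_times)
  also have "\<dots> \<subseteq> e * e" using c(2) s(3) by (intro set_times_mono2) auto
  finally have "X * {d * s} \<subseteq> e" using \<alpha>_times[OF e] by blast
  moreover have "Y * {d * s} = Y * {d} * {s}"
    by (simp add: mult.assoc singleton_times)
  then have "Y * {d * s} \<subseteq> e * e" using d(2) s(1) set_times_mono2[of "Y * {d}" e "{s}" e] by auto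
  then have "Y * {d * s} \<subseteq> e" using \<alpha>_times[OF e] by blast
  ultimately show ?thesis using that[of "d * s"] d s by simp
qed

lemma frac_right_ideal_common_denominator:
  assumes e: "e \<in> \<alpha>" and X: "frac_right_ideal e X" and Y: "frac_right_ideal e Y"
  obtains c where "c \<in> U" "{c} * X \<subseteq> e" "{c} * Y \<subseteq> e"
proof -
  obtain c d where c: "c \<in> U" "{c} * X \<subseteq> e" and d: "d \<in> U" "{d} * Y \<subseteq> e"
    using X Y by (auto simp: frac_right_ideal_def)
  obtain s where s: "s \<in> e" "s \<in> U" "s * (d * unit_inv c) \<in> e"
    using order_left_denominator[OF \<alpha>_semigroup_order[OF e]] by blast
  have "{s * d} * X = {s * (d * unit_inv c)} * ({c} * X)"
    using c by (simp add: mult.assoc singleton_times flip: mult.assoc[of _ _ X])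
  also have "\<dots> \<subseteq> e * e" using c(2) s(3) by (intro set_times_mono2) auto
  finally have "{s * d} * X \<subseteq> e" using \<alpha>_times[OF e] by blast
  moreover have "{s * d} * Y = {s} * ({d} * Y)"
    by (simp add: singleton_times flip: mult.assoc)
  then have "{s * d} * Y \<subseteq> e * e" using d(2) s(1) set_times_mono2[of "{s}" e "{d} * Y" e] by auto
  then have "{s * d} * Y \<subseteq> e" using \<alpha>_times[OF e] by blast
  ultimately show ?thesis using that[of "s * d"] d s by simp
qed

lemma frac_left_ideal_Int:
  assumes e: "e \<in> \<alpha>" and X: "frac_left_ideal e X" and Y: "frac_left_ideal e Y"
  shows "frac_left_ideal e (X \<inter> Y)"
proof -
  obtain x y where x: "x \<in> X" "x \<in> U" and y: "y \<in> Y" "y \<in> U" and eX: "e * X \<subseteq> X" "e * Y \<subseteq> Y"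
    using X Y by (auto simp: frac_left_ideal_def)
  \<comment> \<open>The unit common to \<open>X\<close> and \<open>Y\<close> is \<open>s x\<close>,
    which is also \<open>(s x y^-1) y\<close> with the bracket in \<open>e\<close>.\<close>
  obtain s where s: "s \<in> e" "s \<in> U" "s * (x * unit_inv y) \<in> e"
    using order_left_denominator[OF \<alpha>_semigroup_order[OF e]] by blast
  have "s * (x * unit_inv y) * y \<in> Y"
    using eX s y by (auto simp: times_subset_iff)
  then have "s * x \<in> Y" using y by (simp add: mult.assoc)
  moreover have "s * x \<in> X" using eX s x by (auto simp: times_subset_iff)
  ultimately have 1: "s * x \<in> (X \<inter> Y) \<inter> U" using s x by simp
  have 2: "e * (X \<inter> Y) \<subseteq> X \<inter> Y"
    using eX by (auto simp: times_subset_iff)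
  obtain c where c: "c \<in> U" "X * {c} \<subseteq> e"
    using X by (auto simp: frac_left_ideal_def)
  have "(X \<inter> Y) * {c} \<subseteq> e"
    using c(2) by (auto simp: times_subset_iff)
  with 1 2 c(1) show ?thesis unfolding frac_left_ideal_def by blast
qed

lemma frac_right_ideal_Int:
  assumes e: "e \<in> \<alpha>" and X: "frac_right_ideal e X" and Y: "frac_right_ideal e Y"
  shows "frac_right_ideal e (X \<inter> Y)"
proof -
  obtain x y where x: "x \<in> X" "x \<in> U" and y: "y \<in> Y" "y \<in> U" and eX: "X * e \<subseteq> X" "Y * e \<subseteq> Y"
    using X Y by (auto simp: frac_right_ideal_def)
  obtain s where s: "s \<in> e" "s \<in> U" "unit_inv y * x * s \<in> e"
    using order_right_denominator[OF \<alpha>_semigroup_order[OF e]] by blast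
  have "y * (unit_inv y * x * s) \<in> Y"
    using eX s y by (auto simp: times_subset_iff)
  then have "x * s \<in> Y" using y by (simp add: mult.assoc)
  moreover have "x * s \<in> X" using eX s x by (auto simp: times_subset_iff)
  ultimately have 1: "x * s \<in> (X \<inter> Y) \<inter> U" using s x by simp
  have 2: "(X \<inter> Y) * e \<subseteq> X \<inter> Y"
    using eX by (auto simp: times_subset_iff)
  obtain c where c: "c \<in> U" "{c} * X \<subseteq> e"
    using X by (auto simp: frac_right_ideal_def)
  have "{c} * (X \<inter> Y) \<subseteq> e"
    using c(2) by (auto simp: times_subset_iff)
  with 1 2 c(1) show ?thesis unfolding frac_right_ideal_def by blast
qed

lemma frac_left_ideal_Union:
  assumes "M \<noteq> {}" "\<And>X. X \<in> M \<Longrightarrow> frac_left_ideal e X" "c \<in> U" "\<And>X. X \<in> M \<Longrightarrow> X * {c} \<subseteq> e"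
  shows "frac_left_ideal e (\<Union>M)"
proof -
  have "e * \<Union>M \<subseteq> \<Union>M"
    using assms(2) by (simp add: frac_left_ideal_def times_subset_iff) blast
  moreover have "\<Union>M * {c} \<subseteq> e"
    using assms(4) by (simp add: times_subset_iff)
  moreover have "\<Union>M \<inter> U \<noteq> {}"
    using assms(1,2) unfolding frac_left_ideal_def by blast
  ultimately show ?thesis
    unfolding frac_left_ideal_def using assms(3) by blast
qed

lemma frac_right_ideal_Union:
  assumes "M \<noteq> {}" "\<And>X. X \<in> M \<Longrightarrow> frac_right_ideal e X" "c \<in> U" "\<And>X. X \<in> M \<Longrightarrow> {c} * X \<subseteq> e"
  shows "frac_right_ideal e (\<Union>M)"
proof -
  have "\<Union>M * e \<subseteq> \<Union>M"
    using assms(2) by (simp add: frac_right_ideal_def times_subset_iff) blast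
  moreover have "{c} * \<Union>M \<subseteq> e"
    using assms(4) by (simp add: times_subset_iff)
  moreover have "\<Union>M \<inter> U \<noteq> {}"
    using assms(1,2) unfolding frac_right_ideal_def by blast
  ultimately show ?thesis
    unfolding frac_right_ideal_def using assms(3) by blast
qed

lemma v_closure_frac_left:
  assumes e: "e \<in> \<alpha>" and X: "frac_left_ideal e X"
  shows "v_closure X \<in> F.hom_from e"
proof -
  have "left_order X = e" "fractional X"
    using X frac_left_ideal_iff[OF e] by auto
  then show ?thesis
    using e by (simp add: hom_from_eq frac_left_ideal_iff left_order_v_closure fractional_v_closure
        divisorial_v_closure)
qed

lemma v_closure_frac_right:
  assumes e: "e \<in> \<alpha>" and X: "frac_right_ideal e X"
  shows "v_closure X \<in> F.hom_to e"
proof -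
  have "right_order X = e" "fractional X"
    using X frac_right_ideal_iff[OF e] by auto
  then show ?thesis
    using e by (simp add: hom_to_eq frac_right_ideal_iff right_order_v_closure fractional_v_closure
        divisorial_v_closure)
qed

lemma v_closure_least_left:
  assumes e: "e \<in> \<alpha>" and X: "frac_left_ideal e X" and W: "W \<in> F.hom_from e" and sub: "X \<subseteq> W"
  shows "v_closure X \<subseteq> W"
  using v_closure_mono_left[OF _ _ _ _ sub] X W e
  by (simp add: hom_from_eq frac_left_ideal_iff divisorial_def)

lemma v_closure_least_right:
  assumes e: "e \<in> \<alpha>" and X: "frac_right_ideal e X" and W: "W \<in> F.hom_to e" and sub: "X \<subseteq> W"
  shows "v_closure X \<subseteq> W"
  using v_closure_mono_right[OF _ _ _ _ sub] X W e
  by (simp add: hom_to_eq frac_right_ideal_iff divisorial_def)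

text \<open>The common denominator \<open>c\<close> keeps the union fractional, so its closure is
  the supremum. Pairs get \<open>c\<close> from fractions over \<open>e\<close>; families of
  integral elements take \<open>c = 1\<close>.\<close>

lemma least_hom_from:
  assumes e: "e \<in> \<alpha>" and M: "M \<noteq> {}" "M \<subseteq> F.hom_from e"
    and c: "c \<in> U" "\<And>X. X \<in> M \<Longrightarrow> X * {c} \<subseteq> e"
  shows "least (subposet (\<subseteq>) (F.hom_from e)) (v_closure (\<Union>M)) (Upper (subposet (\<subseteq>) (F.hom_from e)) M)"
proof (rule least_subsetI)
  have X: "frac_left_ideal e (\<Union>M)"
    by (rule frac_left_ideal_Union[OF M(1) _ c]) (use M(2) hom_from_eq[OF e] in auto)
  show "v_closure (\<Union>M) \<in> F.hom_from e" by (rule v_closure_frac_left[OF e X])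
  show "X \<subseteq> v_closure (\<Union>M)" if "X \<in> M" for X
    using subset_v_closure[of "\<Union>M"] that by blast
  show "v_closure (\<Union>M) \<subseteq> W" if "W \<in> F.hom_from e" "\<And>X. X \<in> M \<Longrightarrow> X \<subseteq> W" for W
    using v_closure_least_left[OF e X that(1)] that(2) by blast
qed (rule M(2))

lemma least_hom_to:
  assumes e: "e \<in> \<alpha>" and M: "M \<noteq> {}" "M \<subseteq> F.hom_to e"
    and c: "c \<in> U" "\<And>X. X \<in> M \<Longrightarrow> {c} * X \<subseteq> e"
  shows "least (subposet (\<subseteq>) (F.hom_to e)) (v_closure (\<Union>M)) (Upper (subposet (\<subseteq>) (F.hom_to e)) M)"
proof (rule least_subsetI)
  have X: "frac_right_ideal e (\<Union>M)"
    by (rule frac_right_ideal_Union[OF M(1) _ c]) (use M(2) hom_to_eq[OF e] in auto)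
  show "v_closure (\<Union>M) \<in> F.hom_to e" by (rule v_closure_frac_right[OF e X])
  show "X \<subseteq> v_closure (\<Union>M)" if "X \<in> M" for X
    using subset_v_closure[of "\<Union>M"] that by blast
  show "v_closure (\<Union>M) \<subseteq> W" if "W \<in> F.hom_to e" "\<And>X. X \<in> M \<Longrightarrow> X \<subseteq> W" for W
    using v_closure_least_right[OF e X that(1)] that(2) by blast
qed (rule M(2))

lemma least_pair_hom_from:
  assumes e: "e \<in> \<alpha>" and X: "X \<in> F.hom_from e" and Y: "Y \<in> F.hom_from e"
  shows "least (subposet (\<subseteq>) (F.hom_from e)) (v_closure (X \<union> Y)) (Upper (subposet (\<subseteq>) (F.hom_from e)) {X, Y})"
proof -
  have "frac_left_ideal e X" "frac_left_ideal e Y"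
    using X Y hom_from_eq[OF e] by auto
  then obtain c where "c \<in> U" "X * {c} \<subseteq> e" "Y * {c} \<subseteq> e"
    by (rule frac_left_ideal_common_denominator[OF e])
  then show ?thesis
    using least_hom_from[OF e, of "{X, Y}" c] X Y by auto
qed

lemma least_pair_hom_to:
  assumes e: "e \<in> \<alpha>" and X: "X \<in> F.hom_to e" and Y: "Y \<in> F.hom_to e"
  shows "least (subposet (\<subseteq>) (F.hom_to e)) (v_closure (X \<union> Y)) (Upper (subposet (\<subseteq>) (F.hom_to e)) {X, Y})"
proof -
  have "frac_right_ideal e X" "frac_right_ideal e Y"
    using X Y hom_to_eq[OF e] by auto
  then obtain c where "c \<in> U" "{c} * X \<subseteq> e" "{c} * Y \<subseteq> e"
    by (rule frac_right_ideal_common_denominator[OF e])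
  then show ?thesis
    using least_hom_to[OF e, of "{X, Y}" c] X Y by auto
qed

text \<open>Each of \<open>X\<close> and \<open>Y\<close> is divisorial and contains the
  intersection, hence also its closure.\<close>

lemma Int_hom_from:
  assumes e: "e \<in> \<alpha>" and X: "X \<in> F.hom_from e" and Y: "Y \<in> F.hom_from e"
  shows "X \<inter> Y \<in> F.hom_from e"
proof -
  have XY: "frac_left_ideal e (X \<inter> Y)"
    using X Y by (intro frac_left_ideal_Int[OF e]) (simp_all add: hom_from_eq[OF e])
  have "v_closure (X \<inter> Y) \<subseteq> X \<inter> Y"
    using v_closure_least_left[OF e XY X] v_closure_least_left[OF e XY Y] by blast
  then show ?thesis
    using XY subset_antisym[OF _ subset_v_closure[of "X \<inter> Y"]]
    by (simp add: hom_from_eq[OF e] divisorial_def)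
qed

lemma Int_hom_to:
  assumes e: "e \<in> \<alpha>" and X: "X \<in> F.hom_to e" and Y: "Y \<in> F.hom_to e"
  shows "X \<inter> Y \<in> F.hom_to e"
proof -
  have XY: "frac_right_ideal e (X \<inter> Y)"
    using X Y by (intro frac_right_ideal_Int[OF e]) (simp_all add: hom_to_eq[OF e])
  have "v_closure (X \<inter> Y) \<subseteq> X \<inter> Y"
    using v_closure_least_right[OF e XY X] v_closure_least_right[OF e XY Y] by blast
  then show ?thesis
    using XY subset_antisym[OF _ subset_v_closure[of "X \<inter> Y"]]
    by (simp add: hom_to_eq[OF e] divisorial_def)
qed

lemma greatest_pair_hom_from:
  assumes "e \<in> \<alpha>" "X \<in> F.hom_from e" "Y \<in> F.hom_from e"
  shows "greatest (subposet (\<subseteq>) (F.hom_from e)) (X \<inter> Y) (Lower (subposet (\<subseteq>) (F.hom_from e)) {X, Y})"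
  by (rule greatest_subsetI) (use assms Int_hom_from in auto)

lemma greatest_pair_hom_to:
  assumes "e \<in> \<alpha>" "X \<in> F.hom_to e" "Y \<in> F.hom_to e"
  shows "greatest (subposet (\<subseteq>) (F.hom_to e)) (X \<inter> Y) (Lower (subposet (\<subseteq>) (F.hom_to e)) {X, Y})"
  by (rule greatest_subsetI) (use assms Int_hom_to in auto)

lemma lattice_hom_from: "e \<in> \<alpha> \<Longrightarrow> lattice (subposet (\<subseteq>) (F.hom_from e))"
  using least_pair_hom_from greatest_pair_hom_from by (intro lattice_subsetI) blast+

lemma lattice_hom_to: "e \<in> \<alpha> \<Longrightarrow> lattice (subposet (\<subseteq>) (F.hom_to e))"
  using least_pair_hom_to greatest_pair_hom_to by (intro lattice_subsetI) blast+

lemma join_hom_from: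
  "e \<in> \<alpha> \<Longrightarrow> X \<in> F.hom_from e \<Longrightarrow> Y \<in> F.hom_from e \<Longrightarrow>
    X \<squnion>\<^bsub>subposet (\<subseteq>) (F.hom_from e)\<^esub> Y = v_closure (X \<union> Y)"
  unfolding join_def by (intro partial_order.sup_eqI partial_order_subset least_pair_hom_from)

lemma join_hom_to:
  "e \<in> \<alpha> \<Longrightarrow> X \<in> F.hom_to e \<Longrightarrow> Y \<in> F.hom_to e \<Longrightarrow>
    X \<squnion>\<^bsub>subposet (\<subseteq>) (F.hom_to e)\<^esub> Y = v_closure (X \<union> Y)"
  unfolding join_def by (intro partial_order.sup_eqI partial_order_subset least_pair_hom_to)

lemma meet_hom_from:
  "e \<in> \<alpha> \<Longrightarrow> X \<in> F.hom_from e \<Longrightarrow> Y \<in> F.hom_from e \<Longrightarrow>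
    X \<sqinter>\<^bsub>subposet (\<subseteq>) (F.hom_from e)\<^esub> Y = X \<inter> Y"
  unfolding meet_def by (intro partial_order.inf_eqI partial_order_subset greatest_pair_hom_from)

lemma meet_hom_to:
  "e \<in> \<alpha> \<Longrightarrow> X \<in> F.hom_to e \<Longrightarrow> Y \<in> F.hom_to e \<Longrightarrow>
    X \<sqinter>\<^bsub>subposet (\<subseteq>) (F.hom_to e)\<^esub> Y = X \<inter> Y"
  unfolding meet_def by (intro partial_order.inf_eqI partial_order_subset greatest_pair_hom_to)

lemma hom_Int: "F.hom e f = F.hom_from e \<inter> F.hom_to f"
  by (auto simp: F.hom_def F.hom_from_def F.hom_to_def)

text \<open>Joins and meets in \<open>hom_from e\<close> and in \<open>hom_to f\<close> are given by
  the same formulas, \<open>v_closure (X \<union> Y)\<close> and \<open>X \<inter> Y\<close>, which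
  do not refer to a side. So the two lattices agree on \<open>hom e f\<close>.\<close>

sublocale F: lattice_ordered_groupoid "Fv \<alpha>" v_mult left_order right_order "(\<subseteq>)"
proof (intro lattice_ordered_groupoid.intro F.groupoid_axioms lattice_ordered_groupoid_axioms.intro,
    unfold identities_eq hom_Int)
  fix e f a b assume ef: "e \<in> \<alpha>" "f \<in> \<alpha>"
    and "a \<in> F.hom_from e \<inter> F.hom_to f" "b \<in> F.hom_from e \<inter> F.hom_to f"
  then have ab: "a \<in> F.hom_from e" "b \<in> F.hom_from e" "a \<in> F.hom_to f" "b \<in> F.hom_to f"
    by simp_all
  show "a \<sqinter>\<^bsub>subposet (\<subseteq>) (F.hom_from e)\<^esub> b \<in> F.hom_from e \<inter> F.hom_to f"
    "a \<sqinter>\<^bsub>subposet (\<subseteq>) (F.hom_from e)\<^esub> b = a \<sqinter>\<^bsub>subposet (\<subseteq>) (F.hom_to f)\<^esub> b"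
    "a \<squnion>\<^bsub>subposet (\<subseteq>) (F.hom_from e)\<^esub> b = a \<squnion>\<^bsub>subposet (\<subseteq>) (F.hom_to f)\<^esub> b"
    using ef ab by (simp_all add: meet_hom_from meet_hom_to join_hom_from join_hom_to
        Int_hom_from Int_hom_to)
  show "a \<squnion>\<^bsub>subposet (\<subseteq>) (F.hom_from e)\<^esub> b \<in> F.hom_from e \<inter> F.hom_to f"
    using least_closed[OF least_pair_hom_from[OF ef(1) ab(1,2)]]
      least_closed[OF least_pair_hom_to[OF ef(2) ab(3,4)]] ef ab
    by (simp add: join_hom_from)
qed (simp_all add: lattice_hom_from lattice_hom_to)

section \<open>Transfer along links\<close>

lemma mem_integral_iff: "I \<in> F.integral \<longleftrightarrow> I \<in> Fv \<alpha> \<and> I \<subseteq> left_order I"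
  using subset_left_order_iff_subset_right_order[of I] by (auto simp: F.integral_def)

lemma mem_integral_iff_right: "I \<in> F.integral \<longleftrightarrow> I \<in> Fv \<alpha> \<and> I \<subseteq> right_order I"
  using subset_left_order_iff_subset_right_order[of I] by (simp add: mem_integral_iff)

lemma divisorial_left_ideals_eq:
  assumes e: "e \<in> \<alpha>"
  shows "{I. left_ideal e I \<and> divisorial I} = F.hom_from e \<inter> F.integral"
proof -
  have "F.hom_from e \<inter> F.integral = {I \<in> F.hom_from e. I \<subseteq> e}"
    by (auto simp: F.hom_from_def mem_integral_iff)
  then show ?thesis
    by (auto simp: hom_from_eq[OF e] left_ideal_def)
qed

lemma divisorial_right_ideals_eq:
  assumes e: "e \<in> \<alpha>"
  shows "{I. right_ideal e I \<and> divisorial I} = F.hom_to e \<inter> F.integral"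
proof -
  have "F.hom_to e \<inter> F.integral = {I \<in> F.hom_to e. I \<subseteq> e}"
    by (auto simp: F.hom_to_def mem_integral_iff_right)
  then show ?thesis
    by (auto simp: hom_to_eq[OF e] right_ideal_def)
qed

lemma modular_divisorial_iff:
  "e \<in> \<alpha> \<Longrightarrow> modular_divisorial e \<longleftrightarrow>
    modular_lattice (subposet (\<subseteq>) (F.hom_from e)) \<and> modular_lattice (subposet (\<subseteq>) (F.hom_to e))"
  by (simp add: modular_divisorial_def hom_from_eq hom_to_eq)

lemma ACC_divisorial_iff:
  "e \<in> \<alpha> \<Longrightarrow> ACC_divisorial e \<longleftrightarrow>
    ACC_on (\<subseteq>) (F.hom_from e \<inter> F.integral) \<and> ACC_on (\<subseteq>) (F.hom_to e \<inter> F.integral)"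
  by (simp add: ACC_divisorial_def divisorial_left_ideals_eq divisorial_right_ideals_eq)

lemma exists_linking:
  assumes e: "e \<in> \<alpha>" and f: "f \<in> \<alpha>"
  shows "\<exists>K. linking e f K"
proof -
  obtain c d where u: "c \<in> U" "d \<in> U" and ced: "{c} * e * {d} \<subseteq> f"
    using \<alpha>_equiv[OF e f] by (rule order_equivE)
  have "linking e f (e * {d} * f)"
  proof (rule linkingI_right[OF e f])
    show "e * (e * {d} * f) \<subseteq> e * {d} * f"
      using times_mono_left[OF \<alpha>_times[OF e], of "{d} * f"] by (simp add: mult.assoc)
    have 1: "e * {d} * f * f \<subseteq> e * {d} * f"
      using times_mono_right[OF \<alpha>_times[OF f], of "e * {d}"] by (simp add: mult.assoc)
    have "1 * d * 1 \<in> e * {d} * f"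
      using \<alpha>_one[OF e] \<alpha>_one[OF f] by (intro set_times_intro) auto
    then have 2: "d \<in> e * {d} * f \<inter> U" using u by simp
    have "{c} * (e * {d} * f) = {c} * e * {d} * f" by (simp add: mult.assoc)
    also have "\<dots> \<subseteq> f * f" by (rule times_mono_left[OF ced])
    also have "\<dots> \<subseteq> f" by (rule \<alpha>_times[OF f])
    finally show "frac_right_ideal f (e * {d} * f)"
      unfolding frac_right_ideal_def using 1 2 u by blast
  qed
  then show ?thesis by blast
qed

section \<open>Multiplication by a link as an isomorphism\<close>

lemma v_mult_inv_cancel_left:
  assumes K: "linking e f K" and X: "linking f g X" "divisorial X"
  shows "v_mult (ideal_inv K) (v_mult K X) = X"
proof -
  have "v_mult (ideal_inv K) (v_mult K X) = v_mult (v_mult (ideal_inv K) K) X"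
    by (rule v_mult_assoc[OF linking_inv[OF K] K X(1), symmetric])
  also have "v_mult (ideal_inv K) K = left_order X"
    using v_closure_inv_times[OF K] X(1) by (simp add: v_mult_def linking_def)
  finally show ?thesis using v_mult_left_unit linking_Fv[OF X] by simp
qed

lemma v_mult_cancel_left:
  assumes K: "linking e f K" and X: "linking e g X" "divisorial X"
  shows "v_mult K (v_mult (ideal_inv K) X) = X"
proof -
  have "v_mult K (v_mult (ideal_inv K) X) = v_mult (v_mult K (ideal_inv K)) X"
    by (rule v_mult_assoc[OF K linking_inv[OF K] X(1), symmetric])
  also have "v_mult K (ideal_inv K) = left_order X"
    using v_closure_times_inv[OF K] X(1) by (simp add: v_mult_def linking_def)
  finally show ?thesis using v_mult_left_unit linking_Fv[OF X] by simp
qed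

lemma v_mult_cancel_right:
  assumes K: "linking e f K" and X: "linking g e X" "divisorial X"
  shows "v_mult (v_mult X K) (ideal_inv K) = X"
proof -
  have "v_mult (v_mult X K) (ideal_inv K) = v_mult X (v_mult K (ideal_inv K))"
    by (rule v_mult_assoc[OF X(1) K linking_inv[OF K]])
  also have "v_mult K (ideal_inv K) = right_order X"
    using v_closure_times_inv[OF K] X(1) by (simp add: v_mult_def linking_def)
  finally show ?thesis using v_mult_right_unit linking_Fv[OF X] by simp
qed

lemma v_mult_inv_cancel_right:
  assumes K: "linking e f K" and X: "linking g f X" "divisorial X"
  shows "v_mult (v_mult X (ideal_inv K)) K = X"
proof -
  have "v_mult (v_mult X (ideal_inv K)) K = v_mult X (v_mult (ideal_inv K) K)"
    by (rule v_mult_assoc[OF X(1) linking_inv[OF K] K])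
  also have "v_mult (ideal_inv K) K = right_order X"
    using v_closure_inv_times[OF K] X(1) by (simp add: v_mult_def linking_def)
  finally show ?thesis using v_mult_right_unit linking_Fv[OF X] by simp
qed

lemma v_mult_hom_from:
  "linking e f K \<Longrightarrow> X \<in> F.hom_from f \<Longrightarrow> v_mult K X \<in> F.hom_from e"
  using linking_v_mult[of e f K "right_order X" X] v_mult_Fv[of e f K "right_order X" X]
  unfolding hom_from_iff by (auto simp: Fv_iff linking_def)

lemma v_mult_hom_to:
  "linking e f K \<Longrightarrow> X \<in> F.hom_to e \<Longrightarrow> v_mult X K \<in> F.hom_to f"
  using linking_v_mult[of "left_order X" e X f K] v_mult_Fv[of "left_order X" e X f K]
  unfolding hom_to_iff by (auto simp: Fv_iff linking_def)

lemma v_mult_mono_hom_from: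
  assumes "linking e f K" "X \<in> F.hom_from f" "Y \<in> F.hom_from f" "X \<subseteq> Y"
  shows "v_mult K X \<subseteq> v_mult K Y"
  using v_mult_mono[OF assms(1,1) _ _ order_refl assms(4)] assms(2,3) by (auto simp: hom_from_iff)

lemma v_mult_mono_hom_to:
  assumes "linking e f K" "X \<in> F.hom_to e" "Y \<in> F.hom_to e" "X \<subseteq> Y"
  shows "v_mult X K \<subseteq> v_mult Y K"
  using v_mult_mono_right[OF _ _ assms(1,1) assms(4) order_refl] assms(2,3) by (auto simp: hom_to_iff)

text \<open>Multiplication by \<open>K^-1\<close> undoes multiplication by \<open>K\<close>, and
  both are monotone. Any link serves, so this transfer is available before integral links are known
  to exist.\<close>

lemma modular_hom_from_transfer:
  assumes h: "h \<in> \<alpha>" and e: "e \<in> \<alpha>" and mod: "modular_lattice (subposet (\<subseteq>) (F.hom_from h))"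
  shows "modular_lattice (subposet (\<subseteq>) (F.hom_from e))"
proof -
  obtain K where K: "linking h e K" using exists_linking[OF h e] by blast
  have cancel: "v_mult (ideal_inv K) (v_mult K X) = X" if "X \<in> F.hom_from e" for X
    using v_mult_inv_cancel_left[OF K] that by (auto simp: hom_from_iff)
  have "Y \<in> v_mult K ` F.hom_from e" if Y: "Y \<in> F.hom_from h" for Y
  proof
    show "Y = v_mult K (v_mult (ideal_inv K) Y)"
      using v_mult_cancel_left[OF K] Y by (auto simp: hom_from_iff)
    show "v_mult (ideal_inv K) Y \<in> F.hom_from e"
      by (rule v_mult_hom_from[OF linking_inv[OF K] Y])
  qed
  then have image: "v_mult K ` F.hom_from e = F.hom_from h"
    using v_mult_hom_from[OF K] by blast
  have "v_mult K X \<subseteq> v_mult K Y \<longleftrightarrow> X \<subseteq> Y" if X: "X \<in> F.hom_from e" and Y: "Y \<in> F.hom_from e" for X Y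
    using v_mult_mono_hom_from[OF K X Y] cancel[OF X] cancel[OF Y]
      v_mult_mono_hom_from[OF linking_inv[OF K] v_mult_hom_from[OF K X] v_mult_hom_from[OF K Y]]
    by auto
  then show ?thesis
    by (intro modular_lattice_iso[OF mod lattice_hom_from[OF e], of "v_mult K"]) (simp_all add: image)
qed

lemma modular_hom_to_transfer:
  assumes h: "h \<in> \<alpha>" and e: "e \<in> \<alpha>" and mod: "modular_lattice (subposet (\<subseteq>) (F.hom_to h))"
  shows "modular_lattice (subposet (\<subseteq>) (F.hom_to e))"
proof -
  \<comment> \<open>Right multiplication changes targets, so the link now runs from \<open>e\<close>
    to \<open>h\<close>.\<close>
  obtain K where K: "linking e h K" using exists_linking[OF e h] by blast
  have cancel: "v_mult (v_mult X K) (ideal_inv K) = X" if "X \<in> F.hom_to e" for X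
    using v_mult_cancel_right[OF K] that by (auto simp: hom_to_iff)
  have "Y \<in> (\<lambda>X. v_mult X K) ` F.hom_to e" if Y: "Y \<in> F.hom_to h" for Y
  proof
    show "Y = v_mult (v_mult Y (ideal_inv K)) K"
      using v_mult_inv_cancel_right[OF K] Y by (auto simp: hom_to_iff)
    show "v_mult Y (ideal_inv K) \<in> F.hom_to e"
      by (rule v_mult_hom_to[OF linking_inv[OF K] Y])
  qed
  then have image: "(\<lambda>X. v_mult X K) ` F.hom_to e = F.hom_to h"
    using v_mult_hom_to[OF K] by blast
  have "v_mult X K \<subseteq> v_mult Y K \<longleftrightarrow> X \<subseteq> Y" if X: "X \<in> F.hom_to e" and Y: "Y \<in> F.hom_to e" for X Y
    using v_mult_mono_hom_to[OF K X Y] cancel[OF X] cancel[OF Y]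
      v_mult_mono_hom_to[OF linking_inv[OF K] v_mult_hom_to[OF K X] v_mult_hom_to[OF K Y]]
    by auto
  then show ?thesis
    by (intro modular_lattice_iso[OF mod lattice_hom_to[OF e], of "\<lambda>X. v_mult X K"])
      (simp_all add: image)
qed

lemma linking_integral_iff: "linking e f I \<Longrightarrow> I \<subseteq> e \<longleftrightarrow> I \<subseteq> f"
  using subset_left_order_iff_subset_right_order[of I] by (auto simp: linking_def)

text \<open>One has \<open>K X \<subseteq> K f \<subseteq> K \<subseteq> e\<close>, and the closure
  stays inside because \<open>e\<close> is divisorial.\<close>

lemma v_mult_integral_left:
  assumes K: "linking e f K" "K \<subseteq> e" and X: "X \<in> F.hom_from f \<inter> F.integral"
  shows "v_mult K X \<in> F.hom_from e \<inter> F.integral"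
proof -
  have h: "v_mult K X \<in> F.hom_from e" using v_mult_hom_from[OF K(1)] X by blast
  have L: "linking f (right_order X) X" and Xf: "X \<subseteq> f"
    using X by (auto simp: hom_from_iff mem_integral_iff linking_def)
  have e: "e \<in> \<alpha>" using K(1) by (simp add: linking_def)
  have "K * X \<subseteq> K * f" by (rule times_mono_right[OF Xf])
  also have "\<dots> \<subseteq> e" using linking_times_right[OF K(1)] K(2) by blast
  finally have "v_mult K X \<subseteq> e"
    unfolding v_mult_def
    by (rule v_closure_least_left[OF e linking_frac_left[OF linking_mult[OF K(1) L]], rotated])
      (simp add: F.hom_from_def \<alpha>_Fv e \<alpha>_left_order)
  then show ?thesis
    using h by (simp add: mem_integral_iff F.hom_from_def)
qed

lemma v_mult_integral_right:
  assumes K: "linking e f K" "K \<subseteq> f" and X: "X \<in> F.hom_to e \<inter> F.integral"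
  shows "v_mult X K \<in> F.hom_to f \<inter> F.integral"
proof -
  have h: "v_mult X K \<in> F.hom_to f" using v_mult_hom_to[OF K(1)] X by blast
  have L: "linking (left_order X) e X" and Xe: "X \<subseteq> e"
    using X by (auto simp: hom_to_iff mem_integral_iff_right linking_def)
  have f: "f \<in> \<alpha>" using K(1) by (simp add: linking_def)
  have "X * K \<subseteq> e * K" by (rule times_mono_left[OF Xe])
  also have "\<dots> \<subseteq> f" using linking_left_times[OF K(1)] K(2) by blast
  finally have "v_mult X K \<subseteq> f"
    unfolding v_mult_def
    by (rule v_closure_least_right[OF f linking_frac_right[OF linking_mult[OF L K(1)]], rotated])
      (simp add: F.hom_to_def \<alpha>_Fv f \<alpha>_right_order)
  then show ?thesis
    using h by (simp add: mem_integral_iff_right F.hom_to_def)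
qed

text \<open>The integral elements of \<open>e\<close> are embedded into those of \<open>h\<close>,
  in general not onto them, since \<open>K^-1\<close> need not preserve integrality. An embedding is
  enough for chains.\<close>

lemma ACC_hom_from_transfer:
  assumes K: "linking h e K" "K \<subseteq> h" and acc: "ACC_on (\<subseteq>) (F.hom_from h \<inter> F.integral)"
  shows "ACC_on (\<subseteq>) (F.hom_from e \<inter> F.integral)"
proof (rule ACC_on_embed[OF acc, of _ "v_mult K"])
  show "v_mult K X \<in> F.hom_from h \<inter> F.integral" if "X \<in> F.hom_from e \<inter> F.integral" for X
    by (rule v_mult_integral_left[OF K that])
  show "v_mult K X \<subseteq> v_mult K Y"
    if "X \<in> F.hom_from e \<inter> F.integral" "Y \<in> F.hom_from e \<inter> F.integral" "X \<subseteq> Y" for X Y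
    by (rule v_mult_mono_hom_from[OF K(1)]) (use that in auto)
  show "inj_on (v_mult K) (F.hom_from e \<inter> F.integral)"
    by (rule inj_on_inverseI[of _ "v_mult (ideal_inv K)"])
      (use v_mult_inv_cancel_left[OF K(1)] in \<open>auto simp: hom_from_iff\<close>)
qed

lemma ACC_hom_to_transfer:
  assumes K: "linking e h K" "K \<subseteq> h" and acc: "ACC_on (\<subseteq>) (F.hom_to h \<inter> F.integral)"
  shows "ACC_on (\<subseteq>) (F.hom_to e \<inter> F.integral)"
proof (rule ACC_on_embed[OF acc, of _ "\<lambda>X. v_mult X K"])
  show "v_mult X K \<in> F.hom_to h \<inter> F.integral" if "X \<in> F.hom_to e \<inter> F.integral" for X
    by (rule v_mult_integral_right[OF K that])
  show "v_mult X K \<subseteq> v_mult Y K"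
    if "X \<in> F.hom_to e \<inter> F.integral" "Y \<in> F.hom_to e \<inter> F.integral" "X \<subseteq> Y" for X Y
    by (rule v_mult_mono_hom_to[OF K(1)]) (use that in auto)
  show "inj_on (\<lambda>X. v_mult X K) (F.hom_to e \<inter> F.integral)"
    by (rule inj_on_inverseI[of _ "\<lambda>X. v_mult X (ideal_inv K)"])
      (use v_mult_cancel_right[OF K(1)] in \<open>auto simp: hom_to_iff\<close>)
qed

section \<open>Boundedness and integral links\<close>

lemma frac_ideal_linking: "h \<in> \<alpha> \<Longrightarrow> frac_ideal h J \<longleftrightarrow> linking h h J"
  by (auto simp: frac_ideal_def frac_left_ideal_iff frac_right_ideal_iff linking_def)

text \<open>
  With links \<open>K\<close> from \<open>e\<close> to \<open>h\<close> and \<open>L\<close> from \<open>h\<close> to \<open>f\<close>, and two-sided ideals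
  \<open>I\<close>, \<open>J\<close> inside the inverses of \<open>K\<close> and \<open>L\<close>, the product \<open>K I J L\<close> is integral.
\<close>

lemma bounded_imp_integral_link:
  assumes h: "h \<in> \<alpha>" and b: "bounded_order h" and e: "e \<in> \<alpha>" and f: "f \<in> \<alpha>"
  shows "\<exists>X. linking e f X \<and> X \<subseteq> f"
proof -
  obtain K L where K: "linking e h K" and L: "linking h f L"
    using exists_linking e f h by blast
  obtain I where I: "linking h h I" "I \<subseteq> ideal_inv K"
    using b linking_frac_left[OF linking_inv[OF K]] frac_ideal_linking[OF h]
    unfolding bounded_order_def by blast
  obtain J where J: "linking h h J" "J \<subseteq> ideal_inv L"
    using b linking_frac_right[OF linking_inv[OF L]] frac_ideal_linking[OF h]
    unfolding bounded_order_def by blast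
  note KI = linking_mult[OF K I(1)] and JL = linking_mult[OF J(1) L]
  have "K * I \<subseteq> e"
    using times_mono_right[OF I(2), of K] linking_times_inv[OF K] by blast
  \<comment> \<open>Integrality of \<open>K I\<close> is read off at the end \<open>e\<close> and
    used at the end \<open>h\<close>, which \<open>J L\<close> absorbs.\<close>
  then have "K * I \<subseteq> h" using linking_integral_iff[OF KI] by simp
  then have "K * I * (J * L) \<subseteq> h * (J * L)" by (rule times_mono_left)
  also have "\<dots> \<subseteq> J * L" by (rule linking_left_times[OF JL])
  also have "\<dots> \<subseteq> f"
    using times_mono_left[OF J(2), of L] linking_inv_times[OF L] by blast
  finally show ?thesis using linking_mult[OF KI JL] by blast
qed

text \<open>As \<open>a^-1\<close> lies in the inverse of \<open>h a\<close>, it multiplies the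
  closure into the right order of that inverse, which is \<open>h\<close>. Multiplying back by
  \<open>a\<close> puts the closure inside \<open>h a\<close>.\<close>

lemma v_closure_principal_left:
  assumes h: "h \<in> \<alpha>" and a: "a \<in> U"
  shows "frac_left_ideal h (h * {a})" "v_closure (h * {a}) = h * {a}"
proof -
  have inv: "h * {a} * {unit_inv a} = h"
    using a by (simp add: mult.assoc singleton_times flip: set_one)
  have "h * (h * {a}) \<subseteq> h * {a}"
    using times_mono_left[OF \<alpha>_times[OF h], of "{a}"] by (simp add: mult.assoc)
  moreover have "1 * a \<in> h * {a}"
    using \<alpha>_one[OF h] by (intro set_times_intro) auto
  ultimately show X: "frac_left_ideal h (h * {a})"
    unfolding frac_left_ideal_def using a inv by auto
  then have lo: "left_order (h * {a}) = h" and fr: "fractional (h * {a})"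
    using frac_left_ideal_iff[OF h] by auto
  have "{unit_inv a} \<subseteq> ideal_inv (h * {a})"
    using inv lo by (simp only: subset_ideal_inv_iff_left)
  then have "v_closure (h * {a}) * {unit_inv a} \<subseteq> v_closure (h * {a}) * ideal_inv (h * {a})"
    by (rule times_mono_right)
  also have "\<dots> \<subseteq> right_order (ideal_inv (h * {a}))"
    unfolding v_closure_def by (rule ideal_inv_times)
  also have "\<dots> = h" using right_order_inv[OF fr] lo h by simp
  finally have "v_closure (h * {a}) * {unit_inv a} * {a} \<subseteq> h * {a}" by (rule times_mono_left)
  then have "v_closure (h * {a}) \<subseteq> h * {a}"
    using a by (simp add: mult.assoc singleton_times flip: set_one)
  then show "v_closure (h * {a}) = h * {a}"
    using subset_v_closure by blast
qed

lemma v_closure_principal_right: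
  assumes h: "h \<in> \<alpha>" and a: "a \<in> U"
  shows "frac_right_ideal h ({a} * h)" "v_closure ({a} * h) = {a} * h"
proof -
  have inv: "{unit_inv a} * ({a} * h) = h"
    using a by simp
  have "{a} * h * h \<subseteq> {a} * h"
    using times_mono_right[OF \<alpha>_times[OF h], of "{a}"] by (simp add: mult.assoc)
  moreover have "a * 1 \<in> {a} * h"
    using \<alpha>_one[OF h] by (intro set_times_intro) auto
  ultimately show X: "frac_right_ideal h ({a} * h)"
    unfolding frac_right_ideal_def using a inv by (metis IntI empty_iff mult_1_right order_refl unit_inv_unit)
  then have lo: "right_order ({a} * h) = h" and fr: "fractional ({a} * h)"
    using frac_right_ideal_iff[OF h] by auto
  have "{unit_inv a} \<subseteq> ideal_inv ({a} * h)"
    using inv lo by (simp only: subset_ideal_inv_iff_right)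
  then have "{unit_inv a} * v_closure ({a} * h) \<subseteq> ideal_inv ({a} * h) * v_closure ({a} * h)"
    by (rule times_mono_left)
  also have "\<dots> \<subseteq> left_order (ideal_inv ({a} * h))"
    unfolding v_closure_def by (rule times_ideal_inv)
  also have "\<dots> = h" using left_order_inv[OF fr] lo h by simp
  finally have "{a} * ({unit_inv a} * v_closure ({a} * h)) \<subseteq> {a} * h" by (rule times_mono_right)
  then have "v_closure ({a} * h) \<subseteq> {a} * h"
    using a by simp
  then show "v_closure ({a} * h) = {a} * h"
    using subset_v_closure by blast
qed

lemma integral_link_imp_bounded:
  assumes int: "\<And>e f. e \<in> \<alpha> \<Longrightarrow> f \<in> \<alpha> \<Longrightarrow> \<exists>X. linking e f X \<and> X \<subseteq> f" and h: "h \<in> \<alpha>"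
  shows "bounded_order h"
  unfolding bounded_order_def
proof (intro conjI allI impI)
  fix I assume I: "frac_left_ideal h I"
  then obtain a where a: "a \<in> I" "a \<in> U" and hI: "h * I \<subseteq> I" by (auto simp: frac_left_ideal_def)
  have sub: "h * {a} \<subseteq> I" using times_mono_right[of "{a}" I h] a hI by auto
  let ?X = "h * {a}"
  have X: "divisorial ?X" "fractional ?X" "left_order ?X = h"
    using v_closure_principal_left[OF h a(2)] frac_left_ideal_iff[OF h] by (auto simp: divisorial_def)
  \<comment> \<open>The right order of \<open>h a\<close> is the conjugate \<open>a^-1 h a\<close>;
    it is in \<alpha> because principal ideals are divisorial.\<close>
  have r: "right_order ?X \<in> \<alpha>" by (rule right_order_mem[OF X(1,2)]) (simp add: X h)
  then have L: "linking h (right_order ?X) ?X" using X h by (simp add: linking_def)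
  obtain J where J: "linking (right_order ?X) h J" "J \<subseteq> right_order ?X"
    using int[OF r h] linking_integral_iff by blast
  have "?X * J \<subseteq> ?X"
    using times_mono_right[OF J(2), of ?X] times_right_order[of ?X] by blast
  then show "\<exists>J. frac_ideal h J \<and> J \<subseteq> I"
    using linking_mult[OF L J(1)] frac_ideal_linking[OF h] sub by blast
next
  fix I assume I: "frac_right_ideal h I"
  then obtain a where a: "a \<in> I" "a \<in> U" and hI: "I * h \<subseteq> I" by (auto simp: frac_right_ideal_def)
  have sub: "{a} * h \<subseteq> I" using times_mono_left[of "{a}" I h] a hI by auto
  let ?X = "{a} * h"
  have X: "divisorial ?X" "fractional ?X" "right_order ?X = h"
    using v_closure_principal_right[OF h a(2)] frac_right_ideal_iff[OF h] by (auto simp: divisorial_def)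
  have r: "left_order ?X \<in> \<alpha>" by (rule left_order_mem[OF X(1,2)]) (simp add: X h)
  then have L: "linking (left_order ?X) h ?X" using X h by (simp add: linking_def)
  obtain J where J: "linking h (left_order ?X) J" "J \<subseteq> left_order ?X"
    using int[OF h r] by blast
  have "J * ?X \<subseteq> ?X"
    using times_mono_left[OF J(2), of ?X] left_order_times[of ?X] by blast
  then show "\<exists>J. frac_ideal h J \<and> J \<subseteq> I"
    using linking_mult[OF J(1) L] frac_ideal_linking[OF h] sub by blast
qed

text \<open>Since \<open>f\<close> is divisorial, the closure of an integral link stays inside
  \<open>f\<close>. So P5 can be discussed without closures.\<close>

lemma integral_link_iff:
  assumes f: "f \<in> \<alpha>"
  shows "(\<exists>X. linking e f X \<and> X \<subseteq> f) \<longleftrightarrow> F.hom e f \<inter> F.integral \<noteq> {}"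
proof
  assume "\<exists>X. linking e f X \<and> X \<subseteq> f"
  then obtain X where X: "linking e f X" "X \<subseteq> f" by blast
  have "v_closure X \<subseteq> f"
    by (rule v_closure_least_right[OF f linking_frac_right[OF X(1)] _ X(2)])
      (simp add: F.hom_to_def \<alpha>_Fv f \<alpha>_right_order)
  then have "v_closure X \<in> F.hom e f \<inter> F.integral"
    using linking_v_closure[OF X(1)] linking_divisorial[OF X(1)]
    by (simp add: hom_iff mem_integral_iff_right Fv_iff linking_def)
  then show "F.hom e f \<inter> F.integral \<noteq> {}" by blast
next
  assume "F.hom e f \<inter> F.integral \<noteq> {}"
  then show "\<exists>X. linking e f X \<and> X \<subseteq> f"
    by (auto simp: hom_iff mem_integral_iff_right linking_def)
qed

lemma least_hom_from_integral:
  assumes e: "e \<in> \<alpha>" and M: "M \<noteq> {}" "M \<subseteq> F.hom_from e \<inter> F.integral"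
  shows "least (subposet (\<subseteq>) (F.hom_from e)) (v_closure (\<Union>M)) (Upper (subposet (\<subseteq>) (F.hom_from e)) M)"
proof (rule least_hom_from[OF e M(1) _ one_unit])
  show "X * {1} \<subseteq> e" if "X \<in> M" for X
    using subsetD[OF M(2) that] by (auto simp: mem_integral_iff F.hom_from_def simp flip: set_one)
qed (use M in blast)

lemma least_hom_to_integral:
  assumes e: "e \<in> \<alpha>" and M: "M \<noteq> {}" "M \<subseteq> F.hom_to e \<inter> F.integral"
  shows "least (subposet (\<subseteq>) (F.hom_to e)) (v_closure (\<Union>M)) (Upper (subposet (\<subseteq>) (F.hom_to e)) M)"
proof (rule least_hom_to[OF e M(1) _ one_unit])
  show "{1} * X \<subseteq> e" if "X \<in> M" for X
    using subsetD[OF M(2) that] by (auto simp: mem_integral_iff_right F.hom_to_def simp flip: set_one)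
qed (use M in blast)

text \<open>P1, P3 and P4 hold for every class \<alpha>. P2 and P6 are (A3) and (A1) for all members
  at once, and P5 is stated through integral links, the form in which boundedness supplies
  it.\<close>

lemma arithmetical_groupoid_iff:
  "arithmetical_groupoid (Fv \<alpha>) v_mult left_order right_order (\<subseteq>) \<longleftrightarrow>
    (\<forall>e\<in>\<alpha>. modular_divisorial e \<and> ACC_divisorial e) \<and>
    (\<forall>e\<in>\<alpha>. \<forall>f\<in>\<alpha>. \<exists>X. linking e f X \<and> X \<subseteq> f)"
    (is "?A \<longleftrightarrow> ?R")
proof
  assume ?A
  then interpret A: arithmetical_groupoid "Fv \<alpha>" v_mult left_order right_order "(\<subseteq>)" .
  show ?R
    using A.P2_from A.P2_to A.P5 A.P6_from A.P6_to
    by (simp add: identities_eq modular_divisorial_iff ACC_divisorial_iff integral_link_iff)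
next
  assume R: ?R
  show ?A
  proof (intro arithmetical_groupoid.intro F.lattice_ordered_groupoid_axioms
      arithmetical_groupoid_axioms.intro, unfold identities_eq)
    show "a \<subseteq> left_order a \<longleftrightarrow> a \<subseteq> right_order a" for a :: "'a set"
      by (rule subset_left_order_iff_subset_right_order)
    fix e assume e: "e \<in> \<alpha>"
    show "modular_lattice (subposet (\<subseteq>) (F.hom_from e))" "modular_lattice (subposet (\<subseteq>) (F.hom_to e))"
      "ACC_on (\<subseteq>) (F.hom_from e \<inter> F.integral)" "ACC_on (\<subseteq>) (F.hom_to e \<inter> F.integral)"
      using R e modular_divisorial_iff[OF e] ACC_divisorial_iff[OF e] by blast+
    show "v_mult c a \<subseteq> v_mult c b"
      if "a \<in> F.hom_from e" "b \<in> F.hom_from e" "a \<subseteq> b" "c \<in> F.hom_to e" for a b c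
      using v_mult_mono_hom_from[OF _ that(1-3)] that(4) by (auto simp: hom_to_iff)
    show "v_mult a c \<subseteq> v_mult b c"
      if "a \<in> F.hom_to e" "b \<in> F.hom_to e" "a \<subseteq> b" "c \<in> F.hom_from e" for a b c
      using v_mult_mono_hom_to[OF _ that(1-3)] that(4) by (auto simp: hom_from_iff)
    show "\<exists>u. least (subposet (\<subseteq>) (F.hom_from e)) u (Upper (subposet (\<subseteq>) (F.hom_from e)) M)"
      if "M \<noteq> {}" "M \<subseteq> F.hom_from e \<inter> F.integral" for M
      using least_hom_from_integral[OF e that] by blast
    show "\<exists>u. least (subposet (\<subseteq>) (F.hom_to e)) u (Upper (subposet (\<subseteq>) (F.hom_to e)) M)"
      if "M \<noteq> {}" "M \<subseteq> F.hom_to e \<inter> F.integral" for M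
      using least_hom_to_integral[OF e that] by blast
    fix f assume f: "f \<in> \<alpha>"
    show "F.hom e f \<inter> F.integral \<noteq> {}"
      using R e f integral_link_iff by blast
    show "\<Squnion>\<^bsub>subposet (\<subseteq>) (F.hom_from e)\<^esub> M = \<Squnion>\<^bsub>subposet (\<subseteq>) (F.hom_to f)\<^esub> M"
      if M: "M \<noteq> {}" "M \<subseteq> F.hom e f \<inter> F.integral" for M
    proof -
      have "M \<subseteq> F.hom_from e \<inter> F.integral" "M \<subseteq> F.hom_to f \<inter> F.integral"
        using M(2) by (auto simp: hom_Int)
      then show ?thesis
        using partial_order.sup_eqI[OF partial_order_subset least_hom_from_integral[OF e M(1)]]
          partial_order.sup_eqI[OF partial_order_subset least_hom_to_integral[OF f M(1)]]
        by simp
    qed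
  qed
qed

end

theorem proposition5p16:
  fixes \<alpha> :: "'a::monoid_mult set set"
  assumes "quotient_semigroup TYPE('a)"
    and "maximal_order_class \<alpha>"
  shows "(arithmetical_groupoid (Fv \<alpha>) v_mult left_order right_order (\<subseteq>) \<longleftrightarrow>
            (\<forall>H\<in>\<alpha>. ACC_divisorial H \<and> bounded_order H \<and> modular_divisorial H)) \<and>
         (arithmetical_groupoid (Fv \<alpha>) v_mult left_order right_order (\<subseteq>) \<longleftrightarrow>
            (\<exists>H\<in>\<alpha>. ACC_divisorial H \<and> bounded_order H \<and> modular_divisorial H))"
proof -
  interpret order_class \<alpha>
    by (rule order_class.intro) (fact assms)+
  have all: "\<forall>H\<in>\<alpha>. ACC_divisorial H \<and> bounded_order H \<and> modular_divisorial H"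
    if "arithmetical_groupoid (Fv \<alpha>) v_mult left_order right_order (\<subseteq>)"
    using that integral_link_imp_bounded unfolding arithmetical_groupoid_iff by blast
  have arith: "arithmetical_groupoid (Fv \<alpha>) v_mult left_order right_order (\<subseteq>)"
    if h: "h \<in> \<alpha>" and A: "ACC_divisorial h" "bounded_order h" "modular_divisorial h" for h
    unfolding arithmetical_groupoid_iff
  proof (intro conjI ballI)
    fix e assume e: "e \<in> \<alpha>"
    show "modular_divisorial e"
      using modular_hom_from_transfer[OF h e] modular_hom_to_transfer[OF h e] A(3)
      by (simp add: modular_divisorial_iff h e)
    \<comment> \<open>Two integral links in opposite directions are used: \<open>K\<close> from
      \<open>h\<close> for left multiplication and \<open>L\<close> into \<open>h\<close> for right
      multiplication. Both come from boundedness of \<open>h\<close> alone.\<close>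
    obtain K where K: "linking h e K" "K \<subseteq> h"
      using bounded_imp_integral_link[OF h A(2) h e] linking_integral_iff by blast
    obtain L where L: "linking e h L" "L \<subseteq> h"
      using bounded_imp_integral_link[OF h A(2) e h] by blast
    show "ACC_divisorial e"
      using ACC_hom_from_transfer[OF K] ACC_hom_to_transfer[OF L] A(1)
      by (simp add: ACC_divisorial_iff h e)
    show "\<exists>X. linking e f X \<and> X \<subseteq> f" if "f \<in> \<alpha>" for f
      by (rule bounded_imp_integral_link[OF h A(2) e that])
  qed
  \<comment> \<open>The three statements form a cycle; the passage from all members to one uses that
    \<alpha> is non-empty.\<close>
  show ?thesis
    using all arith \<alpha>_nonempty by blast
qed

end
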